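(* Let $k$ be a field with $\mathrm{char}(k)\neq2$, and let $\pi:H^3_{\rm ab}(C_2\times C_2,k^* )\to H^3(C_2\times C_2,k^* )$ be the homomorphism $[(\phi,\mathcal R)]\mapsto[\phi]$. The subgroup $\pi^{-1}([1])$ of $H^3_{\rm ab}(C_2\times C_2,k^* )$, where $1$ denotes the trivial $3$-cocycle, is isomorphic to $C_2\times C_2\times C_2$. Its elements are the classes $[(1,\mathcal R)]$, with $\mathcal R$ given by the following data: $\mathcal R(e,x)=\mathcal R(x,e)=1$ for all $x$, and $$\mathcal R(x,x)=\mu_x\ \text{ with }\ \mu_x^2=1\quad\text{for all }x\in\{\sigma,\tau,\rho\},$$ $$\mathcal R(\sigma,\tau)=1,\quad \mathcal R(\tau,\sigma)=\mu_\sigma\mu_\tau\mu_\rho,\quad \mathcal R(\sigma,\rho)=\mu_\sigma,$$ $$\mathcal R(\rho,\sigma)=\mu_\tau\mu_\rho,\quad \mathcal R(\tau,\rho)=\mu_\sigma\mu_\rho,\quad \mathcal R(\rho,\tau)=\mu_\tau.$$ Moreover, $EM(\pi^{-1}([1]))$ is the subgroup of $QF(C_2\times C_2,k^* )$ generated by $A$, $B$ and $C$.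
   Context: $C_2\times C_2=\{e,\sigma,\tau,\rho\}$ is the Klein group, with $\sigma\tau=\tau\sigma=\rho$, $\sigma^2=\tau^2=e$. $k^*=k\setminus\{0\}$. For a group $G$, a $3$-cocycle is a map $\phi:G^3\to k^*$ with $\phi(y,z,t)\phi(x,yz,t)\phi(x,y,z)=\phi(xy,z,t)\phi(x,y,zt)$; it is normalized if $\phi(x,e,z)=1$ for all $x,z$. For $\psi:G^2\to k^*$, $\Delta_2(\psi)(x,y,z)=\psi(y,z)\psi(xy,z)^{-1}\psi(x,yz)\psi(x,y)^{-1}$; $H^3(G,k^* )$ is $3$-cocycles modulo the $\Delta_2(\psi)$. For $G$ abelian, an abelian $3$-cocycle is a pair $(\phi,\mathcal R)$ with $\phi$ a normalized $3$-cocycle and $\mathcal R:G\times G\to k^*$ such that for all $x,y,z$: $\mathcal R(xy,z)\phi(x,z,y)=\phi(x,y,z)\mathcal R(x,z)\phi(z,x,y)\mathcal R(y,z)$ and $\phi(x,y,z)\mathcal R(x,yz)\phi(y,z,x)=\mathcal R(x,y)\phi(y,x,z)\mathcal R(x,z)$. These form a group under pointwise multiplication. Abelian coboundaries are the pairs $(\Delta_2(\psi),\mathcal R_\psi)$ with $\psi:G^2\to k^*$ satisfying $\psi(e,x)=\psi(y,e)$ for all $x,y$, and $\mathcal R_\psi(x,y)=\psi(x,y)^{-1}\psi(y,x)$. $H^3_{\rm ab}(G,k^* )$ is the quotient group. $QF(G,k^* )$ is the group (pointwise multiplication) of quadratic forms: maps $Q:G\to k^*$ with $Q(x^{-1})=Q(x)$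 and $Q(xyz)Q(x)Q(y)Q(z)=Q(xy)Q(xz)Q(yz)$. $EM:H^3_{\rm ab}(G,k^* )\to QF(G,k^* )$ sends $[(\phi,\mathcal R)]$ to $Q$, $Q(x)=\mathcal R(x,x)$ (an isomorphism by Eilenberg–Mac Lane). The quadratic forms $A,B,C$ on $C_2\times C_2$: all take value $1$ at $e$; $A(\rho)=-1$, $A(\sigma)=A(\tau)=1$; $B(\tau)=-1$, $B(\sigma)=B(\rho)=1$; $C(\sigma)=-1$, $C(\tau)=C(\rho)=1$. *)

theory Defs
  imports "HOL-Algebra.Product_Groups"
begin

section \<open>Cochains with values in the multiplicative group of a field\<close>

definition kstar :: "'k::field itself \<Rightarrow> 'k monoid" where
  "kstar _ = \<lparr>carrier = - {0}, monoid.mult = (*), one = 1\<rparr>"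

text \<open>Maps from \<open>I\<close> to \<open>k\<^sup>*\<close> under pointwise multiplication. They are
  extensional, i.e. take an irrelevant fixed value outside \<open>I\<close>. A map of several arguments is
  represented by a map on tuples.\<close>

definition cochains :: "'x set \<Rightarrow> 'k::field itself \<Rightarrow> ('x \<Rightarrow> 'k) monoid" where
  "cochains I k = product_group I (\<lambda>_. kstar k)"

abbreviation G2 :: "'g monoid \<Rightarrow> ('g \<times> 'g) set" where
  "G2 G \<equiv> carrier G \<times> carrier G"

abbreviation G3 :: "'g monoid \<Rightarrow> ('g \<times> 'g \<times> 'g) set" where
  "G3 G \<equiv> carrier G \<times> carrier G \<times> carrier G"


section \<open>Third cohomology\<close>

definition cocycle3 :: "'g monoid \<Rightarrow> ('g \<times> 'g \<times> 'g \<Rightarrow> 'k::field) \<Rightarrow> bool" where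
  "cocycle3 G \<phi> \<longleftrightarrow>
    (\<forall>x\<in>carrier G. \<forall>y\<in>carrier G. \<forall>z\<in>carrier G. \<forall>t\<in>carrier G.
      \<phi> (y, z, t) * \<phi> (x, y \<otimes>\<^bsub>G\<^esub> z, t) * \<phi> (x, y, z) =
      \<phi> (x \<otimes>\<^bsub>G\<^esub> y, z, t) * \<phi> (x, y, z \<otimes>\<^bsub>G\<^esub> t))"

definition normalized3 :: "'g monoid \<Rightarrow> ('g \<times> 'g \<times> 'g \<Rightarrow> 'k::field) \<Rightarrow> bool" where
  "normalized3 G \<phi> \<longleftrightarrow> (\<forall>x\<in>carrier G. \<forall>z\<in>carrier G. \<phi> (x, \<one>\<^bsub>G\<^esub>, z) = 1)"

definition \<Delta>2 :: "'g monoid \<Rightarrow> ('g \<times> 'g \<Rightarrow> 'k::field) \<Rightarrow> ('g \<times> 'g \<times> 'g \<Rightarrow> 'k)" where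
  "\<Delta>2 G \<psi> = (\<lambda>(x, y, z)\<in>G3 G.
    \<psi> (y, z) * inverse (\<psi> (x \<otimes>\<^bsub>G\<^esub> y, z)) * \<psi> (x, y \<otimes>\<^bsub>G\<^esub> z) * inverse (\<psi> (x, y)))"

definition Z3 :: "'g monoid \<Rightarrow> 'k::field itself \<Rightarrow> ('g \<times> 'g \<times> 'g \<Rightarrow> 'k) monoid" where
  "Z3 G k = cochains (G3 G) k \<lparr>carrier := {\<phi> \<in> carrier (cochains (G3 G) k). cocycle3 G \<phi>}\<rparr>"

definition B3 :: "'g monoid \<Rightarrow> 'k::field itself \<Rightarrow> ('g \<times> 'g \<times> 'g \<Rightarrow> 'k) set" where
  "B3 G k = \<Delta>2 G ` carrier (cochains (G2 G) k)"

definition H3 :: "'g monoid \<Rightarrow> 'k::field itself \<Rightarrow> ('g \<times> 'g \<times> 'g \<Rightarrow> 'k) set monoid" where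
  "H3 G k = Z3 G k Mod B3 G k"

definition H3_class :: "'g monoid \<Rightarrow> ('g \<times> 'g \<times> 'g \<Rightarrow> 'k::field) \<Rightarrow> ('g \<times> 'g \<times> 'g \<Rightarrow> 'k) set" where
  "H3_class G \<phi> = B3 G TYPE('k) #>\<^bsub>Z3 G TYPE('k)\<^esub> \<phi>"

definition triv3 :: "'g monoid \<Rightarrow> 'k::field itself \<Rightarrow> 'g \<times> 'g \<times> 'g \<Rightarrow> 'k" where
  "triv3 G k = (\<lambda>_\<in>G3 G. 1)"


section \<open>Third abelian cohomology\<close>

definition abelian_cocycle3 ::
  "'g monoid \<Rightarrow> ('g \<times> 'g \<times> 'g \<Rightarrow> 'k::field) \<Rightarrow> ('g \<times> 'g \<Rightarrow> 'k) \<Rightarrow> bool" where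
  "abelian_cocycle3 G \<phi> R \<longleftrightarrow> cocycle3 G \<phi> \<and> normalized3 G \<phi> \<and>
    (\<forall>x\<in>carrier G. \<forall>y\<in>carrier G. \<forall>z\<in>carrier G.
      R (x \<otimes>\<^bsub>G\<^esub> y, z) * \<phi> (x, z, y) = \<phi> (x, y, z) * R (x, z) * \<phi> (z, x, y) * R (y, z) \<and>
      \<phi> (x, y, z) * R (x, y \<otimes>\<^bsub>G\<^esub> z) * \<phi> (y, z, x) = R (x, y) * \<phi> (y, x, z) * R (x, z))"

definition Z3ab :: "'g monoid \<Rightarrow> 'k::field itself \<Rightarrow>
    (('g \<times> 'g \<times> 'g \<Rightarrow> 'k) \<times> ('g \<times> 'g \<Rightarrow> 'k)) monoid" where
  "Z3ab G k = (cochains (G3 G) k \<times>\<times> cochains (G2 G) k)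
    \<lparr>carrier := {(\<phi>, R). \<phi> \<in> carrier (cochains (G3 G) k) \<and> R \<in> carrier (cochains (G2 G) k) \<and>
       abelian_cocycle3 G \<phi> R}\<rparr>"

definition R_cob :: "'g monoid \<Rightarrow> ('g \<times> 'g \<Rightarrow> 'k::field) \<Rightarrow> ('g \<times> 'g \<Rightarrow> 'k)" where
  "R_cob G \<psi> = (\<lambda>(x, y)\<in>G2 G. inverse (\<psi> (x, y)) * \<psi> (y, x))"

definition B3ab :: "'g monoid \<Rightarrow> 'k::field itself \<Rightarrow>
    (('g \<times> 'g \<times> 'g \<Rightarrow> 'k) \<times> ('g \<times> 'g \<Rightarrow> 'k)) set" where
  "B3ab G k = (\<lambda>\<psi>. (\<Delta>2 G \<psi>, R_cob G \<psi>)) `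
    {\<psi> \<in> carrier (cochains (G2 G) k).
      \<forall>x\<in>carrier G. \<forall>y\<in>carrier G. \<psi> (\<one>\<^bsub>G\<^esub>, x) = \<psi> (y, \<one>\<^bsub>G\<^esub>)}"

definition H3ab :: "'g monoid \<Rightarrow> 'k::field itself \<Rightarrow>
    (('g \<times> 'g \<times> 'g \<Rightarrow> 'k) \<times> ('g \<times> 'g \<Rightarrow> 'k)) set monoid" where
  "H3ab G k = Z3ab G k Mod B3ab G k"

definition H3ab_class :: "'g monoid \<Rightarrow> ('g \<times> 'g \<times> 'g \<Rightarrow> 'k::field) \<times> ('g \<times> 'g \<Rightarrow> 'k) \<Rightarrow>
    (('g \<times> 'g \<times> 'g \<Rightarrow> 'k) \<times> ('g \<times> 'g \<Rightarrow> 'k)) set" where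
  "H3ab_class G p = B3ab G TYPE('k) #>\<^bsub>Z3ab G TYPE('k)\<^esub> p"

text \<open>The map on classes; \<open>the_elem\<close> picks the common value of the representatives
  (see \<open>\<pi>_class\<close> below).\<close>

definition \<pi> :: "'g monoid \<Rightarrow> (('g \<times> 'g \<times> 'g \<Rightarrow> 'k::field) \<times> ('g \<times> 'g \<Rightarrow> 'k)) set \<Rightarrow>
    ('g \<times> 'g \<times> 'g \<Rightarrow> 'k) set" where
  "\<pi> G X = the_elem ((\<lambda>(\<phi>, R). H3_class G \<phi>) ` X)"


definition \<pi>_fibre_one :: "'g monoid \<Rightarrow> 'k::field itself \<Rightarrow>
    (('g \<times> 'g \<times> 'g \<Rightarrow> 'k) \<times> ('g \<times> 'g \<Rightarrow> 'k)) set set" where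
  "\<pi>_fibre_one G k = {X \<in> carrier (H3ab G k). \<pi> G X = H3_class G (triv3 G k)}"


section \<open>Quadratic forms and the Eilenberg--Mac Lane map\<close>

definition quadratic_form :: "'g monoid \<Rightarrow> ('g \<Rightarrow> 'k::field) \<Rightarrow> bool" where
  "quadratic_form G Q \<longleftrightarrow>
    (\<forall>x\<in>carrier G. Q (inv\<^bsub>G\<^esub> x) = Q x) \<and>
    (\<forall>x\<in>carrier G. \<forall>y\<in>carrier G. \<forall>z\<in>carrier G.
      Q (x \<otimes>\<^bsub>G\<^esub> y \<otimes>\<^bsub>G\<^esub> z) * Q x * Q y * Q z =
      Q (x \<otimes>\<^bsub>G\<^esub> y) * Q (x \<otimes>\<^bsub>G\<^esub> z) * Q (y \<otimes>\<^bsub>G\<^esub> z))"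

definition QF :: "'g monoid \<Rightarrow> 'k::field itself \<Rightarrow> ('g \<Rightarrow> 'k) monoid" where
  "QF G k = cochains (carrier G) k
    \<lparr>carrier := {Q \<in> carrier (cochains (carrier G) k). quadratic_form G Q}\<rparr>"

definition EM :: "'g monoid \<Rightarrow> (('g \<times> 'g \<times> 'g \<Rightarrow> 'k::field) \<times> ('g \<times> 'g \<Rightarrow> 'k)) set \<Rightarrow>
    ('g \<Rightarrow> 'k)" where
  "EM G X = the_elem ((\<lambda>(\<phi>, R). \<lambda>x\<in>carrier G. R (x, x)) ` X)"


section \<open>The Klein group\<close>

abbreviation C2 :: "int monoid" where
  "C2 \<equiv> integer_mod_group 2"

abbreviation V4 :: "(int \<times> int) monoid" where
  "V4 \<equiv> C2 \<times>\<times> C2"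

definition e :: "int \<times> int" where "e = (0, 0)"
definition \<sigma> :: "int \<times> int" where "\<sigma> = (1, 0)"
definition \<tau> :: "int \<times> int" where "\<tau> = (0, 1)"
definition \<rho> :: "int \<times> int" where "\<rho> = (1, 1)"

definition qA :: "int \<times> int \<Rightarrow> 'k::field" where
  "qA = (\<lambda>x\<in>carrier V4. if x = \<rho> then -1 else 1)"

definition qB :: "int \<times> int \<Rightarrow> 'k::field" where
  "qB = (\<lambda>x\<in>carrier V4. if x = \<tau> then -1 else 1)"

definition qC :: "int \<times> int \<Rightarrow> 'k::field" where
  "qC = (\<lambda>x\<in>carrier V4. if x = \<sigma> then -1 else 1)"

lemma carrier_V4: "carrier V4 = {e, \<sigma>, \<tau>, \<rho>}"
  by (auto simp: carrier_integer_mod_group e_def \<sigma>_def \<tau>_def \<rho>_def)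

lemma V4_mult:
  "\<one>\<^bsub>V4\<^esub> = e" "\<sigma> \<otimes>\<^bsub>V4\<^esub> \<tau> = \<rho>" "\<tau> \<otimes>\<^bsub>V4\<^esub> \<sigma> = \<rho>" "\<sigma> \<otimes>\<^bsub>V4\<^esub> \<sigma> = e" "\<tau> \<otimes>\<^bsub>V4\<^esub> \<tau> = e"
  by (simp_all add: e_def \<sigma>_def \<tau>_def \<rho>_def)

lemma comm_group_V4: "comm_group V4"
proof -
  have "group V4" by (simp add: DirProd_group)
  then show ?thesis
    by (rule group.group_comm_groupI) (auto simp: add.commute)
qed


section \<open>The quotients, and \<open>\<pi>\<close> and \<open>EM\<close>, are well defined\<close>

lemma kstar_simps [simp]:
  "carrier (kstar k) = - {0}" "x \<otimes>\<^bsub>kstar k\<^esub> y = x * y" "\<one>\<^bsub>kstar k\<^esub> = 1"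
  by (simp_all add: kstar_def)

lemma comm_group_kstar: "comm_group (kstar k)"
proof (rule comm_groupI)
  fix x assume "x \<in> carrier (kstar k)"
  then show "\<exists>y\<in>carrier (kstar k). y \<otimes>\<^bsub>kstar k\<^esub> x = \<one>\<^bsub>kstar k\<^esub>"
    by (intro bexI[of _ "inverse x"]) auto
qed auto

lemma group_kstar [simp]: "group (kstar k)"
  using comm_group_kstar by (rule comm_group.axioms)

lemma inv_kstar [simp]: "x \<noteq> 0 \<Longrightarrow> inv\<^bsub>kstar k\<^esub> x = inverse x"
  by (rule group.inv_equality) auto

lemma cochains_simps [simp]:
  "carrier (cochains I k) = I \<rightarrow>\<^sub>E - {0}"
  "f \<otimes>\<^bsub>cochains I k\<^esub> g = (\<lambda>x\<in>I. f x * g x)"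
  "\<one>\<^bsub>cochains I k\<^esub> = (\<lambda>x\<in>I. 1)"
  by (simp_all add: cochains_def)

lemma group_cochains [simp]: "group (cochains I k)"
  by (simp add: cochains_def)

lemma comm_group_cochains: "comm_group (cochains I k)"
  by (rule group.group_comm_groupI) (auto simp: mult.commute)

lemma inv_cochains [simp]: "f \<in> I \<rightarrow>\<^sub>E - {0} \<Longrightarrow> inv\<^bsub>cochains I k\<^esub> f = (\<lambda>x\<in>I. inverse (f x))"
  unfolding cochains_def by (subst inv_product_group) (auto simp: PiE_iff)

lemma cochain_nonzero: "f \<in> I \<rightarrow>\<^sub>E - {0} \<Longrightarrow> x \<in> I \<Longrightarrow> f x \<noteq> 0"
  by auto

lemma cocycle3_mult:
  assumes "group G" "cocycle3 G f" "cocycle3 G g"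
  shows "cocycle3 G (\<lambda>x\<in>G3 G. f x * g x)"
proof -
  interpret group G by fact
  show ?thesis
    unfolding cocycle3_def
  proof (intro ballI)
    fix x y z t assume *: "x \<in> carrier G" "y \<in> carrier G" "z \<in> carrier G" "t \<in> carrier G"
    show "(\<lambda>x\<in>G3 G. f x * g x) (y, z, t) * (\<lambda>x\<in>G3 G. f x * g x) (x, y \<otimes>\<^bsub>G\<^esub> z, t) *
            (\<lambda>x\<in>G3 G. f x * g x) (x, y, z) =
          (\<lambda>x\<in>G3 G. f x * g x) (x \<otimes>\<^bsub>G\<^esub> y, z, t) * (\<lambda>x\<in>G3 G. f x * g x) (x, y, z \<otimes>\<^bsub>G\<^esub> t)"
      using arg_cong2[where f = "(*)", OF assms(2)[unfolded cocycle3_def, rule_format, OF *]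
          assms(3)[unfolded cocycle3_def, rule_format, OF *]] *
      by (simp add: mult_ac)
  qed
qed

lemma cocycle3_inverse:
  assumes "group G" "cocycle3 G f"
  shows "cocycle3 G (\<lambda>x\<in>G3 G. inverse (f x))"
proof -
  interpret group G by fact
  show ?thesis
    unfolding cocycle3_def
  proof (intro ballI)
    fix x y z t assume *: "x \<in> carrier G" "y \<in> carrier G" "z \<in> carrier G" "t \<in> carrier G"
    show "(\<lambda>x\<in>G3 G. inverse (f x)) (y, z, t) * (\<lambda>x\<in>G3 G. inverse (f x)) (x, y \<otimes>\<^bsub>G\<^esub> z, t) *
            (\<lambda>x\<in>G3 G. inverse (f x)) (x, y, z) =
          (\<lambda>x\<in>G3 G. inverse (f x)) (x \<otimes>\<^bsub>G\<^esub> y, z, t) *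
            (\<lambda>x\<in>G3 G. inverse (f x)) (x, y, z \<otimes>\<^bsub>G\<^esub> t)"
      using arg_cong[where f = inverse, OF assms(2)[unfolded cocycle3_def, rule_format, OF *]] *
      by (simp add: mult_ac)
  qed
qed

lemma comm_group_subgroup:
  assumes "comm_group G" "subgroup H G"
  shows "comm_group (G\<lparr>carrier := H\<rparr>)"
proof -
  interpret comm_group G by fact
  have "group (G\<lparr>carrier := H\<rparr>)"
    using assms(2) is_group by (rule subgroup.subgroup_is_group)
  then show ?thesis
    by (rule group.group_comm_groupI) (use m_comm subgroup.mem_carrier[OF assms(2)] in auto)
qed

lemma triv3_eq: "triv3 G k = \<one>\<^bsub>Z3 G k\<^esub>"
  by (simp add: triv3_def Z3_def)

lemma comm_group_Z3:
  assumes "group G"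
  shows "comm_group (Z3 G k)"
proof -
  interpret group G by fact
  have "subgroup {\<phi> \<in> carrier (cochains (G3 G) k). cocycle3 G \<phi>} (cochains (G3 G) k)"
  proof (rule subgroup.intro)
    show "\<one>\<^bsub>cochains (G3 G) k\<^esub> \<in> {\<phi> \<in> carrier (cochains (G3 G) k). cocycle3 G \<phi>}"
      by (auto simp: cocycle3_def)
  qed (use assms in \<open>auto intro!: cocycle3_mult cocycle3_inverse simp: cochain_nonzero\<close>)
  then show ?thesis
    unfolding Z3_def by (rule comm_group_subgroup[OF comm_group_cochains])
qed

lemma \<Delta>2_carrier:
  assumes "group G" "\<psi> \<in> carrier (cochains (G2 G) k)"
  shows "\<Delta>2 G \<psi> \<in> carrier (Z3 G k)"
proof -
  interpret group G by fact
  have nz: "\<psi> (x, y) \<noteq> 0" if "x \<in> carrier G" "y \<in> carrier G" for x y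
    using assms(2) that by auto
  have "cocycle3 G (\<Delta>2 G \<psi>)"
    by (auto simp: cocycle3_def \<Delta>2_def nz m_assoc field_simps)
  then show ?thesis
    by (auto simp: Z3_def \<Delta>2_def nz)
qed

lemma \<Delta>2_mult:
  assumes "group G"
  shows "\<Delta>2 G (\<lambda>x\<in>G2 G. f x * g x) = (\<lambda>x\<in>G3 G. \<Delta>2 G f x * \<Delta>2 G g x)"
proof -
  interpret group G by fact
  show ?thesis by (auto simp: \<Delta>2_def fun_eq_iff restrict_def mult_ac)
qed

lemma subgroup_B3:
  assumes "group G"
  shows "subgroup (B3 G k) (Z3 G k)"
proof -
  have "group_hom (cochains (G2 G) k) (Z3 G k) (\<Delta>2 G)"
    using assms comm_group.axioms(2)[OF comm_group_Z3[OF assms]]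
    by (auto simp: group_hom_def group_hom_axioms_def hom_def \<Delta>2_mult
        intro!: \<Delta>2_carrier) (simp_all add: Z3_def)
  then show ?thesis
    unfolding B3_def by (rule group_hom.img_is_subgroup)
qed

lemma comm_group_H3: "group G \<Longrightarrow> comm_group (H3 G k)"
  unfolding H3_def
  by (intro comm_group.abelian_FactGroup comm_group_Z3 subgroup_B3)

lemma abelian_cocycle3_mult:
  assumes "group G" "abelian_cocycle3 G f R" "abelian_cocycle3 G g S"
  shows "abelian_cocycle3 G (\<lambda>x\<in>G3 G. f x * g x) (\<lambda>x\<in>G2 G. R x * S x)"
proof -
  interpret group G by fact
  have 1: "cocycle3 G (\<lambda>x\<in>G3 G. f x * g x)"
    using assms by (intro cocycle3_mult) (auto simp: abelian_cocycle3_def)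
  have 2: "normalized3 G (\<lambda>x\<in>G3 G. f x * g x)"
    using assms by (auto simp: abelian_cocycle3_def normalized3_def)
  have f: "R (x \<otimes>\<^bsub>G\<^esub> y, z) * f (x, z, y) = f (x, y, z) * R (x, z) * f (z, x, y) * R (y, z)"
      "f (x, y, z) * R (x, y \<otimes>\<^bsub>G\<^esub> z) * f (y, z, x) = R (x, y) * f (y, x, z) * R (x, z)"
    if "x \<in> carrier G" "y \<in> carrier G" "z \<in> carrier G" for x y z
    using assms(2) that by (auto simp: abelian_cocycle3_def)
  have g: "S (x \<otimes>\<^bsub>G\<^esub> y, z) * g (x, z, y) = g (x, y, z) * S (x, z) * g (z, x, y) * S (y, z)"
      "g (x, y, z) * S (x, y \<otimes>\<^bsub>G\<^esub> z) * g (y, z, x) = S (x, y) * g (y, x, z) * S (x, z)"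
    if "x \<in> carrier G" "y \<in> carrier G" "z \<in> carrier G" for x y z
    using assms(3) that by (auto simp: abelian_cocycle3_def)
  show ?thesis
    unfolding abelian_cocycle3_def
  proof (intro conjI 1 2 ballI)
    fix x y z assume *: "x \<in> carrier G" "y \<in> carrier G" "z \<in> carrier G"
    show "(\<lambda>x\<in>G2 G. R x * S x) (x \<otimes>\<^bsub>G\<^esub> y, z) * (\<lambda>x\<in>G3 G. f x * g x) (x, z, y) =
      (\<lambda>x\<in>G3 G. f x * g x) (x, y, z) * (\<lambda>x\<in>G2 G. R x * S x) (x, z) *
      (\<lambda>x\<in>G3 G. f x * g x) (z, x, y) * (\<lambda>x\<in>G2 G. R x * S x) (y, z)"
      using arg_cong2[where f = "(*)", OF f(1)[OF *] g(1)[OF *]] * by (simp add: mult_ac)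
    show "(\<lambda>x\<in>G3 G. f x * g x) (x, y, z) * (\<lambda>x\<in>G2 G. R x * S x) (x, y \<otimes>\<^bsub>G\<^esub> z) *
      (\<lambda>x\<in>G3 G. f x * g x) (y, z, x) =
      (\<lambda>x\<in>G2 G. R x * S x) (x, y) * (\<lambda>x\<in>G3 G. f x * g x) (y, x, z) *
      (\<lambda>x\<in>G2 G. R x * S x) (x, z)"
      using arg_cong2[where f = "(*)", OF f(2)[OF *] g(2)[OF *]] * by (simp add: mult_ac)
  qed
qed

lemma abelian_cocycle3_inverse:
  assumes "group G" "abelian_cocycle3 G f R"
  shows "abelian_cocycle3 G (\<lambda>x\<in>G3 G. inverse (f x)) (\<lambda>x\<in>G2 G. inverse (R x))"
proof -
  interpret group G by fact
  have 1: "cocycle3 G (\<lambda>x\<in>G3 G. inverse (f x))"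
    using assms by (intro cocycle3_inverse) (auto simp: abelian_cocycle3_def)
  have 2: "normalized3 G (\<lambda>x\<in>G3 G. inverse (f x))"
    using assms by (auto simp: abelian_cocycle3_def normalized3_def)
  have f: "R (x \<otimes>\<^bsub>G\<^esub> y, z) * f (x, z, y) = f (x, y, z) * R (x, z) * f (z, x, y) * R (y, z)"
      "f (x, y, z) * R (x, y \<otimes>\<^bsub>G\<^esub> z) * f (y, z, x) = R (x, y) * f (y, x, z) * R (x, z)"
    if "x \<in> carrier G" "y \<in> carrier G" "z \<in> carrier G" for x y z
    using assms(2) that by (auto simp: abelian_cocycle3_def)
  show ?thesis
    unfolding abelian_cocycle3_def
  proof (intro conjI 1 2 ballI)
    fix x y z assume *: "x \<in> carrier G" "y \<in> carrier G" "z \<in> carrier G"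
    show "(\<lambda>x\<in>G2 G. inverse (R x)) (x \<otimes>\<^bsub>G\<^esub> y, z) * (\<lambda>x\<in>G3 G. inverse (f x)) (x, z, y) =
      (\<lambda>x\<in>G3 G. inverse (f x)) (x, y, z) * (\<lambda>x\<in>G2 G. inverse (R x)) (x, z) *
      (\<lambda>x\<in>G3 G. inverse (f x)) (z, x, y) * (\<lambda>x\<in>G2 G. inverse (R x)) (y, z)"
      using arg_cong[where f = inverse, OF f(1)[OF *]] * by (simp add: mult_ac)
    show "(\<lambda>x\<in>G3 G. inverse (f x)) (x, y, z) * (\<lambda>x\<in>G2 G. inverse (R x)) (x, y \<otimes>\<^bsub>G\<^esub> z) *
      (\<lambda>x\<in>G3 G. inverse (f x)) (y, z, x) =
      (\<lambda>x\<in>G2 G. inverse (R x)) (x, y) * (\<lambda>x\<in>G3 G. inverse (f x)) (y, x, z) *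
      (\<lambda>x\<in>G2 G. inverse (R x)) (x, z)"
      using arg_cong[where f = inverse, OF f(2)[OF *]] * by (simp add: mult_ac)
  qed
qed

lemma comm_group_Z3ab:
  fixes k :: "'k::field itself"
  assumes "group G"
  shows "comm_group (Z3ab G k)"
proof -
  interpret group G by fact
  let ?P = "cochains (G3 G) k \<times>\<times> cochains (G2 G) k"
  let ?S = "{(\<phi>, R). \<phi> \<in> carrier (cochains (G3 G) k) \<and> R \<in> carrier (cochains (G2 G) k) \<and>
       abelian_cocycle3 G \<phi> R}"
  have grp: "group ?P" by (intro DirProd_group group_cochains)
  have P: "comm_group ?P"
    using grp by (rule group.group_comm_groupI) (auto simp: mult.commute)
  have "subgroup ?S ?P"
  proof (rule subgroup.intro)
    show "\<one>\<^bsub>?P\<^esub> \<in> ?S"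
      by (auto simp: abelian_cocycle3_def cocycle3_def normalized3_def)
  next
    fix p q assume "p \<in> ?S" "q \<in> ?S"
    then obtain \<phi> R \<phi>' R' where p: "p = (\<phi>, R)" "\<phi> \<in> G3 G \<rightarrow>\<^sub>E - {0}" "R \<in> G2 G \<rightarrow>\<^sub>E - {0}"
        "abelian_cocycle3 G \<phi> R"
      and q: "q = (\<phi>', R')" "\<phi>' \<in> G3 G \<rightarrow>\<^sub>E - {0}" "R' \<in> G2 G \<rightarrow>\<^sub>E - {0}"
        "abelian_cocycle3 G \<phi>' R'"
      by (cases p; cases q) simp
    have "abelian_cocycle3 G (\<lambda>x\<in>G3 G. \<phi> x * \<phi>' x) (\<lambda>x\<in>G2 G. R x * R' x)"
      by (rule abelian_cocycle3_mult[OF assms p(4) q(4)])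
    moreover have "(\<lambda>x\<in>G3 G. \<phi> x * \<phi>' x) \<in> G3 G \<rightarrow>\<^sub>E - {0}" "(\<lambda>x\<in>G2 G. R x * R' x) \<in> G2 G \<rightarrow>\<^sub>E - {0}"
      using p(2,3) q(2,3) by (simp_all add: PiE_iff)
    ultimately show "p \<otimes>\<^bsub>?P\<^esub> q \<in> ?S"
      by (simp add: p(1) q(1))
  next
    fix p assume "p \<in> ?S"
    then obtain \<phi> R where p: "p = (\<phi>, R)" "\<phi> \<in> G3 G \<rightarrow>\<^sub>E - {0}" "R \<in> G2 G \<rightarrow>\<^sub>E - {0}"
        "abelian_cocycle3 G \<phi> R"
      by (cases p) simp
    then have "inv\<^bsub>?P\<^esub> p = (\<lambda>x\<in>G3 G. inverse (\<phi> x), \<lambda>x\<in>G2 G. inverse (R x))"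
      by (simp add: inv_DirProd)
    moreover have "\<dots> \<in> ?S"
      using p(2,3) abelian_cocycle3_inverse[OF assms p(4)] by (simp add: PiE_iff)
    ultimately show "inv\<^bsub>?P\<^esub> p \<in> ?S" by (simp only:)
  qed (simp add: subset_iff)
  then show ?thesis
    unfolding Z3ab_def by (rule comm_group_subgroup[OF P])
qed

lemma R_cob_mult: "R_cob G (\<lambda>x\<in>G2 G. f x * g x) = (\<lambda>x\<in>G2 G. R_cob G f x * R_cob G g x)"
  by (auto simp: R_cob_def fun_eq_iff restrict_def mult_ac)

lemma abelian_coboundary_carrier:
  assumes "comm_group G" "\<psi> \<in> carrier (cochains (G2 G) k)"
    and "\<forall>x\<in>carrier G. \<forall>y\<in>carrier G. \<psi> (\<one>\<^bsub>G\<^esub>, x) = \<psi> (y, \<one>\<^bsub>G\<^esub>)"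
  shows "(\<Delta>2 G \<psi>, R_cob G \<psi>) \<in> carrier (Z3ab G k)"
proof -
  interpret comm_group G by fact
  have nz: "\<psi> (x, y) \<noteq> 0" if "x \<in> carrier G" "y \<in> carrier G" for x y
    using assms(2) that by auto
  have c: "\<Delta>2 G \<psi> \<in> carrier (Z3 G k)"
    using is_group assms(2) by (rule \<Delta>2_carrier)
  have n: "normalized3 G (\<Delta>2 G \<psi>)"
    unfolding normalized3_def
  proof (intro ballI)
    fix x z assume *: "x \<in> carrier G" "z \<in> carrier G"
    then have "\<psi> (\<one>\<^bsub>G\<^esub>, z) = \<psi> (x, \<one>\<^bsub>G\<^esub>)" using assms(3) by blast
    then show "\<Delta>2 G \<psi> (x, \<one>\<^bsub>G\<^esub>, z) = 1"
      using * by (simp add: \<Delta>2_def nz field_simps)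
  qed
  have "abelian_cocycle3 G (\<Delta>2 G \<psi>) (R_cob G \<psi>)"
    unfolding abelian_cocycle3_def
  proof (intro conjI ballI)
    fix x y z assume *: "x \<in> carrier G" "y \<in> carrier G" "z \<in> carrier G"
    show "R_cob G \<psi> (x \<otimes>\<^bsub>G\<^esub> y, z) * \<Delta>2 G \<psi> (x, z, y) =
        \<Delta>2 G \<psi> (x, y, z) * R_cob G \<psi> (x, z) * \<Delta>2 G \<psi> (z, x, y) * R_cob G \<psi> (y, z)"
      using * by (simp add: \<Delta>2_def R_cob_def nz m_comm[of z] field_simps)
    show "\<Delta>2 G \<psi> (x, y, z) * R_cob G \<psi> (x, y \<otimes>\<^bsub>G\<^esub> z) * \<Delta>2 G \<psi> (y, z, x) =
        R_cob G \<psi> (x, y) * \<Delta>2 G \<psi> (y, x, z) * R_cob G \<psi> (x, z)"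
      using * by (simp add: \<Delta>2_def R_cob_def nz m_comm[of _ x] field_simps)
  qed (use c n in \<open>auto simp: Z3_def\<close>)
  then show ?thesis
    using c by (auto simp: Z3ab_def Z3_def R_cob_def nz)
qed

lemma subgroup_B3ab:
  fixes G :: "'a monoid" and k :: "'k::field itself"
  assumes "comm_group G"
  shows "subgroup (B3ab G k) (Z3ab G k)"
proof -
  interpret comm_group G by fact
  define P :: "('a \<times> 'a \<Rightarrow> 'k) \<Rightarrow> bool"
    where "P \<psi> \<longleftrightarrow> (\<forall>x\<in>carrier G. \<forall>y\<in>carrier G. \<psi> (\<one>\<^bsub>G\<^esub>, x) = \<psi> (y, \<one>\<^bsub>G\<^esub>))" for \<psi>
  have PD: "\<psi> (\<one>\<^bsub>G\<^esub>, x) = \<psi> (y, \<one>\<^bsub>G\<^esub>)" if "P \<psi>" "x \<in> carrier G" "y \<in> carrier G" for \<psi> x y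
    using that unfolding P_def by blast
  let ?S = "{\<psi> \<in> carrier (cochains (G2 G) k). P \<psi>}"
  let ?C = "cochains (G2 G) k \<lparr>carrier := ?S\<rparr>"
  let ?h = "\<lambda>\<psi>. (\<Delta>2 G \<psi>, R_cob G \<psi>)"
  have "subgroup ?S (cochains (G2 G) k)"
  proof (rule subgroup.intro)
    fix f g assume fg: "f \<in> ?S" "g \<in> ?S"
    have "P (\<lambda>x\<in>G2 G. f x * g x)"
      unfolding P_def
    proof (intro ballI)
      fix x y assume xy: "x \<in> carrier G" "y \<in> carrier G"
      have "f (\<one>\<^bsub>G\<^esub>, x) * g (\<one>\<^bsub>G\<^esub>, x) = f (y, \<one>\<^bsub>G\<^esub>) * g (y, \<one>\<^bsub>G\<^esub>)"
        by (rule arg_cong2[where f = "(*)"]; rule PD) (use fg xy in simp_all)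
      then show "(\<lambda>x\<in>G2 G. f x * g x) (\<one>\<^bsub>G\<^esub>, x) = (\<lambda>x\<in>G2 G. f x * g x) (y, \<one>\<^bsub>G\<^esub>)"
        using xy by simp
    qed
    then show "f \<otimes>\<^bsub>cochains (G2 G) k\<^esub> g \<in> ?S"
      using fg by (simp add: PiE_iff)
  next
    fix f assume f: "f \<in> ?S"
    have "P (\<lambda>x\<in>G2 G. inverse (f x))"
      unfolding P_def
    proof (intro ballI)
      fix x y assume xy: "x \<in> carrier G" "y \<in> carrier G"
      have "inverse (f (\<one>\<^bsub>G\<^esub>, x)) = inverse (f (y, \<one>\<^bsub>G\<^esub>))"
        by (rule arg_cong[where f = inverse]; rule PD) (use f xy in simp_all)
      then show "(\<lambda>x\<in>G2 G. inverse (f x)) (\<one>\<^bsub>G\<^esub>, x) = (\<lambda>x\<in>G2 G. inverse (f x)) (y, \<one>\<^bsub>G\<^esub>)"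
        using xy by simp
    qed
    then show "inv\<^bsub>cochains (G2 G) k\<^esub> f \<in> ?S"
      using f by (simp add: PiE_iff)
  next
    have "P (\<lambda>x\<in>G2 G. 1)" unfolding P_def by simp
    then show "\<one>\<^bsub>cochains (G2 G) k\<^esub> \<in> ?S" by simp
  qed (simp add: subset_iff)
  then have "group ?C"
    by (rule subgroup.subgroup_is_group) simp
  moreover have "?h \<in> hom ?C (Z3ab G k)"
  proof (rule homI)
    fix f assume "f \<in> carrier ?C"
    then have "f \<in> carrier (cochains (G2 G) k)" "P f" by simp_all
    then show "?h f \<in> carrier (Z3ab G k)"
      unfolding P_def by (rule abelian_coboundary_carrier[OF assms])
  next
    show "?h (f \<otimes>\<^bsub>?C\<^esub> g) = ?h f \<otimes>\<^bsub>Z3ab G k\<^esub> ?h g" for f g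
      by (simp add: Z3ab_def \<Delta>2_mult R_cob_mult)
  qed
  ultimately have "group_hom ?C (Z3ab G k) ?h"
    using comm_group.axioms(2)[OF comm_group_Z3ab[OF is_group]]
    by (simp add: group_hom_def group_hom_axioms_def)
  then have "subgroup (?h ` carrier ?C) (Z3ab G k)"
    by (rule group_hom.img_is_subgroup)
  then show ?thesis
    unfolding B3ab_def P_def by simp
qed

lemma comm_group_H3ab: "comm_group G \<Longrightarrow> comm_group (H3ab G k)"
  unfolding H3ab_def
  by (intro comm_group.abelian_FactGroup comm_group_Z3ab subgroup_B3ab)
     (auto dest: comm_group.axioms)

lemma comm_group_QF:
  assumes "comm_group G"
  shows "comm_group (QF G k)"
proof -
  interpret comm_group G by fact
  have "subgroup {Q \<in> carrier (cochains (carrier G) k). quadratic_form G Q} (cochains (carrier G) k)"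
  proof (rule subgroup.intro)
    fix f g
    assume fg: "f \<in> {Q \<in> carrier (cochains (carrier G) k). quadratic_form G Q}"
      "g \<in> {Q \<in> carrier (cochains (carrier G) k). quadratic_form G Q}"
    have "quadratic_form G (\<lambda>x\<in>carrier G. f x * g x)"
      unfolding quadratic_form_def
    proof (intro conjI ballI)
      fix x y z assume *: "x \<in> carrier G" "y \<in> carrier G" "z \<in> carrier G"
      have "f (x \<otimes>\<^bsub>G\<^esub> y \<otimes>\<^bsub>G\<^esub> z) * f x * f y * f z = f (x \<otimes>\<^bsub>G\<^esub> y) * f (x \<otimes>\<^bsub>G\<^esub> z) * f (y \<otimes>\<^bsub>G\<^esub> z)"
        "g (x \<otimes>\<^bsub>G\<^esub> y \<otimes>\<^bsub>G\<^esub> z) * g x * g y * g z = g (x \<otimes>\<^bsub>G\<^esub> y) * g (x \<otimes>\<^bsub>G\<^esub> z) * g (y \<otimes>\<^bsub>G\<^esub> z)"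
        using fg * by (auto simp: quadratic_form_def)
      from arg_cong2[where f = "(*)", OF this]
      show "(\<lambda>x\<in>carrier G. f x * g x) (x \<otimes>\<^bsub>G\<^esub> y \<otimes>\<^bsub>G\<^esub> z) * (\<lambda>x\<in>carrier G. f x * g x) x *
          (\<lambda>x\<in>carrier G. f x * g x) y * (\<lambda>x\<in>carrier G. f x * g x) z =
        (\<lambda>x\<in>carrier G. f x * g x) (x \<otimes>\<^bsub>G\<^esub> y) * (\<lambda>x\<in>carrier G. f x * g x) (x \<otimes>\<^bsub>G\<^esub> z) *
          (\<lambda>x\<in>carrier G. f x * g x) (y \<otimes>\<^bsub>G\<^esub> z)"
        using * by (simp add: mult_ac)
    qed (use fg in \<open>auto simp: quadratic_form_def\<close>)
    then show "f \<otimes>\<^bsub>cochains (carrier G) k\<^esub> g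
        \<in> {Q \<in> carrier (cochains (carrier G) k). quadratic_form G Q}"
      using fg by (auto simp: cochain_nonzero)
  next
    fix f assume f: "f \<in> {Q \<in> carrier (cochains (carrier G) k). quadratic_form G Q}"
    have "quadratic_form G (\<lambda>x\<in>carrier G. inverse (f x))"
      unfolding quadratic_form_def
    proof (intro conjI ballI)
      fix x y z assume *: "x \<in> carrier G" "y \<in> carrier G" "z \<in> carrier G"
      have "f (x \<otimes>\<^bsub>G\<^esub> y \<otimes>\<^bsub>G\<^esub> z) * f x * f y * f z = f (x \<otimes>\<^bsub>G\<^esub> y) * f (x \<otimes>\<^bsub>G\<^esub> z) * f (y \<otimes>\<^bsub>G\<^esub> z)"
        using f * by (auto simp: quadratic_form_def)
      from arg_cong[where f = inverse, OF this]
      show "(\<lambda>x\<in>carrier G. inverse (f x)) (x \<otimes>\<^bsub>G\<^esub> y \<otimes>\<^bsub>G\<^esub> z) *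
          (\<lambda>x\<in>carrier G. inverse (f x)) x * (\<lambda>x\<in>carrier G. inverse (f x)) y *
          (\<lambda>x\<in>carrier G. inverse (f x)) z =
        (\<lambda>x\<in>carrier G. inverse (f x)) (x \<otimes>\<^bsub>G\<^esub> y) * (\<lambda>x\<in>carrier G. inverse (f x)) (x \<otimes>\<^bsub>G\<^esub> z) *
          (\<lambda>x\<in>carrier G. inverse (f x)) (y \<otimes>\<^bsub>G\<^esub> z)"
        using * by (simp add: mult_ac)
    qed (use f in \<open>auto simp: quadratic_form_def\<close>)
    then show "inv\<^bsub>cochains (carrier G) k\<^esub> f
        \<in> {Q \<in> carrier (cochains (carrier G) k). quadratic_form G Q}"
      using f by (auto simp: cochain_nonzero)
  qed (auto simp: quadratic_form_def)
  then show ?thesis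
    unfolding QF_def by (rule comm_group_subgroup[OF comm_group_cochains])
qed

lemma the_elem_coset:
  assumes "group Z" "subgroup B Z" "z \<in> carrier Z"
    and "\<And>b. b \<in> B \<Longrightarrow> h (b \<otimes>\<^bsub>Z\<^esub> z) = h z"
  shows "the_elem (h ` (B #>\<^bsub>Z\<^esub> z)) = h z"
proof -
  have "h ` (B #>\<^bsub>Z\<^esub> z) = {h z}"
    using assms(4) subgroup.one_closed[OF assms(2)] by (auto simp: r_coset_def image_iff) 
  then show ?thesis by simp
qed

lemma \<pi>_class:
  fixes \<phi> :: "'g \<times> 'g \<times> 'g \<Rightarrow> 'k::field"
  assumes "comm_group G" "(\<phi>, R) \<in> carrier (Z3ab G TYPE('k))"
  shows "\<pi> G (H3ab_class G (\<phi>, R)) = H3_class G \<phi>"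
proof -
  interpret comm_group G by fact
  interpret Z: comm_group "Z3 G TYPE('k)" by (rule comm_group_Z3) (rule is_group)
  interpret Zab: comm_group "Z3ab G TYPE('k)" by (rule comm_group_Z3ab) (rule is_group)
  note B = subgroup_B3[OF is_group, of "TYPE('k)"]
  have \<phi>: "\<phi> \<in> carrier (Z3 G TYPE('k))"
    using assms(2) by (simp add: Z3_def Z3ab_def abelian_cocycle3_def)
  have "the_elem ((\<lambda>(\<phi>, R). H3_class G \<phi>) ` (B3ab G TYPE('k) #>\<^bsub>Z3ab G TYPE('k)\<^esub> (\<phi>, R))) =
      (\<lambda>(\<phi>, R). H3_class G \<phi>) (\<phi>, R)"
  proof (rule the_elem_coset[OF Zab.is_group subgroup_B3ab[OF assms(1)] assms(2)])
    fix b assume "b \<in> B3ab G TYPE('k)"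
    then obtain \<phi>' R' where b: "b = (\<phi>', R')" "\<phi>' \<in> B3 G TYPE('k)"
      by (auto simp: B3ab_def B3_def)
    have "b \<otimes>\<^bsub>Z3ab G TYPE('k)\<^esub> (\<phi>, R) =
        (\<phi>' \<otimes>\<^bsub>Z3 G TYPE('k)\<^esub> \<phi>, R' \<otimes>\<^bsub>cochains (G2 G) TYPE('k)\<^esub> R)"
      by (simp add: b Z3ab_def Z3_def)
    moreover have "H3_class G (\<phi>' \<otimes>\<^bsub>Z3 G TYPE('k)\<^esub> \<phi>) = H3_class G \<phi>"
      unfolding H3_class_def
      by (rule Z.repr_independence[symmetric]) (use \<phi> b B in \<open>auto simp: r_coset_def\<close>)
    ultimately show "(\<lambda>(\<phi>, R). H3_class G \<phi>) (b \<otimes>\<^bsub>Z3ab G TYPE('k)\<^esub> (\<phi>, R)) =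
        (\<lambda>(\<phi>, R). H3_class G \<phi>) (\<phi>, R)"
      by simp
  qed
  then show ?thesis
    by (simp add: \<pi>_def H3ab_class_def)
qed

lemma EM_class:
  fixes \<phi> :: "'g \<times> 'g \<times> 'g \<Rightarrow> 'k::field"
  assumes "comm_group G" "(\<phi>, R) \<in> carrier (Z3ab G TYPE('k))"
  shows "EM G (H3ab_class G (\<phi>, R)) = (\<lambda>x\<in>carrier G. R (x, x))"
proof -
  interpret comm_group G by fact
  interpret Zab: comm_group "Z3ab G TYPE('k)" by (rule comm_group_Z3ab) (rule is_group)
  let ?h = "\<lambda>(\<phi> :: 'g \<times> 'g \<times> 'g \<Rightarrow> 'k, R :: 'g \<times> 'g \<Rightarrow> 'k). \<lambda>x\<in>carrier G. R (x, x)"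
  have "the_elem (?h ` (B3ab G TYPE('k) #>\<^bsub>Z3ab G TYPE('k)\<^esub> (\<phi>, R))) = ?h (\<phi>, R)"
  proof (rule the_elem_coset[OF Zab.is_group subgroup_B3ab[OF assms(1)] assms(2)])
    fix b assume "b \<in> B3ab G TYPE('k)"
    then obtain \<psi> where b: "b = (\<Delta>2 G \<psi>, R_cob G \<psi>)" "\<psi> \<in> G2 G \<rightarrow>\<^sub>E - {0}"
      by (auto simp: B3ab_def)
    then have "\<psi> (x, x) \<noteq> 0" if "x \<in> carrier G" for x
      using that by auto
    then show "?h (b \<otimes>\<^bsub>Z3ab G TYPE('k)\<^esub> (\<phi>, R)) = ?h (\<phi>, R)"
      by (auto simp: b(1) Z3ab_def R_cob_def fun_eq_iff restrict_def)
  qed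
  then show ?thesis
    by (simp add: EM_def H3ab_class_def)
qed

lemma H3ab_carrierE:
  fixes X :: "(('g \<times> 'g \<times> 'g \<Rightarrow> 'k::field) \<times> ('g \<times> 'g \<Rightarrow> 'k)) set"
  assumes "X \<in> carrier (H3ab G TYPE('k))"
  obtains \<phi> R where "(\<phi>, R) \<in> carrier (Z3ab G TYPE('k))" "X = H3ab_class G (\<phi>, R)"
proof -
  from assms obtain p where "p \<in> carrier (Z3ab G TYPE('k))" "X = H3ab_class G p"
    unfolding H3ab_def carrier_FactGroup H3ab_class_def by (rule imageE)
  then show ?thesis
    using that by (cases p) simp
qed

lemma H3ab_class_mult:
  fixes \<phi> \<phi>' :: "'g \<times> 'g \<times> 'g \<Rightarrow> 'k::field"
  assumes "comm_group G" "(\<phi>, R) \<in> carrier (Z3ab G TYPE('k))" "(\<phi>', R') \<in> carrier (Z3ab G TYPE('k))"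
  shows "H3ab_class G (\<phi>, R) \<otimes>\<^bsub>H3ab G TYPE('k)\<^esub> H3ab_class G (\<phi>', R') =
      H3ab_class G ((\<phi>, R) \<otimes>\<^bsub>Z3ab G TYPE('k)\<^esub> (\<phi>', R'))"
proof -
  interpret comm_group G by fact
  interpret Zab: comm_group "Z3ab G TYPE('k)" by (rule comm_group_Z3ab) (rule is_group)
  interpret normal "B3ab G TYPE('k)" "Z3ab G TYPE('k)"
    by (rule Zab.subgroup_imp_normal[OF subgroup_B3ab[OF assms(1)]])
  show ?thesis
    unfolding H3ab_class_def H3ab_def mult_FactGroup by (rule rcos_sum[OF assms(2,3)])
qed

lemma \<pi>_hom:
  assumes "comm_group G"
  shows "\<pi> G \<in> hom (H3ab G TYPE('k::field)) (H3 G TYPE('k))"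
proof -
  interpret comm_group G by fact
  interpret Z: comm_group "Z3 G TYPE('k)" by (rule comm_group_Z3) (rule is_group)
  interpret Zab: comm_group "Z3ab G TYPE('k)" by (rule comm_group_Z3ab) (rule is_group)
  interpret normal "B3 G TYPE('k)" "Z3 G TYPE('k)"
    by (rule Z.subgroup_imp_normal[OF subgroup_B3[OF is_group]])
  have c: "\<phi> \<in> carrier (Z3 G TYPE('k))" if "(\<phi>, R) \<in> carrier (Z3ab G TYPE('k))" for \<phi> R
    using that by (simp add: Z3_def Z3ab_def abelian_cocycle3_def)
  show ?thesis
  proof (rule homI)
    fix X assume "X \<in> carrier (H3ab G TYPE('k))"
    then obtain \<phi> R where *: "(\<phi>, R) \<in> carrier (Z3ab G TYPE('k))" "X = H3ab_class G (\<phi>, R)"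
      by (rule H3ab_carrierE)
    show "\<pi> G X \<in> carrier (H3 G TYPE('k))"
      unfolding *(2) \<pi>_class[OF assms *(1)] H3_def H3_class_def carrier_FactGroup
      by (rule imageI) (rule c[OF *(1)])
  next
    fix X Y assume XY: "X \<in> carrier (H3ab G TYPE('k))" "Y \<in> carrier (H3ab G TYPE('k))"
    from XY(1) obtain \<phi> R where 1: "(\<phi>, R) \<in> carrier (Z3ab G TYPE('k))"
        "X = H3ab_class G (\<phi>, R)"
      by (rule H3ab_carrierE)
    from XY(2) obtain \<phi>' R' where 2: "(\<phi>', R') \<in> carrier (Z3ab G TYPE('k))"
        "Y = H3ab_class G (\<phi>', R')"
      by (rule H3ab_carrierE)
    have m: "(\<phi>, R) \<otimes>\<^bsub>Z3ab G TYPE('k)\<^esub> (\<phi>', R') =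
        (\<phi> \<otimes>\<^bsub>Z3 G TYPE('k)\<^esub> \<phi>', R \<otimes>\<^bsub>cochains (G2 G) TYPE('k)\<^esub> R')"
      by (simp add: Z3ab_def Z3_def)
    note closed = Zab.m_closed[OF 1(1) 2(1), unfolded m]
    have "\<pi> G (X \<otimes>\<^bsub>H3ab G TYPE('k)\<^esub> Y) = H3_class G (\<phi> \<otimes>\<^bsub>Z3 G TYPE('k)\<^esub> \<phi>')"
      unfolding 1(2) 2(2) H3ab_class_mult[OF assms 1(1) 2(1)] m by (rule \<pi>_class[OF assms closed])
    also have "\<dots> = H3_class G \<phi> \<otimes>\<^bsub>H3 G TYPE('k)\<^esub> H3_class G \<phi>'"
      unfolding H3_class_def H3_def mult_FactGroup
      by (rule rcos_sum[OF c[OF 1(1)] c[OF 2(1)], symmetric])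
    finally show "\<pi> G (X \<otimes>\<^bsub>H3ab G TYPE('k)\<^esub> Y) = \<pi> G X \<otimes>\<^bsub>H3 G TYPE('k)\<^esub> \<pi> G Y"
      unfolding 1(2) 2(2) \<pi>_class[OF assms 1(1)] \<pi>_class[OF assms 2(1)] .
  qed
qed

end

theory Submission
  imports Defs
begin

text \<open>
  The idea is that a class over the trivial class of \<open>H\<^sup>3\<close> is represented by a bicharacter,
  and that on the Klein group bicharacters are matrices of signs.

  With \<open>\<phi> = 1\<close> the two hexagon equations say precisely that \<open>R\<close> is multiplicative in each
  argument (\<open>triv3_Z3ab_iff\<close>). If \<open>[\<phi>] = 1\<close>, say \<open>\<phi> = \<Delta>\<^sub>2 \<psi>\<close>, then normalization of \<open>\<phi>\<close>
  forces \<open>\<psi>(e,x) = \<psi>(y,e)\<close>, so that \<open>\<psi>\<close> also defines an abelian coboundary; dividing by it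
  replaces \<open>\<phi>\<close> by \<open>1\<close> (\<open>\<pi>_fibre_one_bicharacter\<close>). This holds for every abelian group.

  On the Klein group a bicharacter is determined by its values on pairs of the generators
  \<open>\<sigma>, \<tau>\<close>, which are arbitrary signs. A bicharacter \<open>\<psi>\<close> is itself a 2-cocycle, so \<open>(1, R\<^sub>\<psi>)\<close> is an
  abelian coboundary (\<open>bicharacter_coboundary\<close>); one such coboundary takes the value \<open>-1\<close> at
  \<open>(\<sigma>, \<tau>)\<close>, and with it \<open>R(\<sigma>, \<tau>) = 1\<close> can be arranged. The remaining entries are then
  expressed through the diagonal: \<open>\<mu>\<^sub>\<rho> = R(\<sigma>\<tau>, \<sigma>\<tau>) = \<mu>\<^sub>\<sigma> R(\<tau>,\<sigma>) \<mu>\<^sub>\<tau>\<close> gives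
  \<open>R(\<tau>,\<sigma>) = \<mu>\<^sub>\<sigma> \<mu>\<^sub>\<tau> \<mu>\<^sub>\<rho>\<close>, and the row and column of \<open>\<rho>\<close> follow (\<open>\<pi>_fibre_one_normal_table\<close>).

  Writing the three free signs as \<open>(-1)\<^sup>a, (-1)\<^sup>b, (-1)\<^sup>c\<close>, the classes of the normalized bicharacters form the
  image of a homomorphism from \<open>C\<^sub>2\<^sup>3\<close> (\<open>fibre_param_hom\<close>). Composed with \<open>EM\<close>, it sends
  \<open>(a, b, c)\<close> to the quadratic form \<open>(-1)\<^sup>q\<close> with \<open>q(x\<^sub>1,x\<^sub>2) = a x\<^sub>1 + b x\<^sub>2 + c x\<^sub>1 x\<^sub>2\<close> for coordinates
  \<open>x\<^sub>1, x\<^sub>2 \<in> {0, 1}\<close>, whose values at \<open>\<sigma>, \<tau>, \<rho>\<close> determine \<open>a, b, c\<close> because \<open>-1 \<noteq> 1\<close> in \<open>k\<close>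
  (\<open>inj_sign_quadratic\<close>). Hence the parametrization is an isomorphism
  onto the fibre, and the image under \<open>EM\<close> is generated by the images of generators of \<open>C\<^sub>2\<^sup>3\<close>;
  \<open>A, B, C\<close> are the images of \<open>(0,0,1), (0,1,1), (1,0,1)\<close>.
\<close>

section \<open>Bicharacters\<close>

definition bicharacter :: "'g monoid \<Rightarrow> ('g \<times> 'g \<Rightarrow> 'k::field) \<Rightarrow> bool" where
  "bicharacter G R \<longleftrightarrow> (\<forall>x\<in>carrier G. \<forall>y\<in>carrier G. \<forall>z\<in>carrier G.
    R (x \<otimes>\<^bsub>G\<^esub> y, z) = R (x, z) * R (y, z) \<and> R (x, y \<otimes>\<^bsub>G\<^esub> z) = R (x, y) * R (x, z))"

text \<open>For \<open>\<phi> = 1\<close> the two hexagon equations reduce to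
  multiplicativity of \<open>R\<close> in the first and in the second argument.\<close>
lemma triv3_Z3ab_iff:
  assumes "comm_group G"
  shows "(triv3 G TYPE('k::field), R) \<in> carrier (Z3ab G TYPE('k)) \<longleftrightarrow>
    R \<in> carrier (cochains (G2 G) TYPE('k)) \<and> bicharacter G R"
proof -
  interpret comm_group G by fact
  have "abelian_cocycle3 G (triv3 G TYPE('k)) R \<longleftrightarrow> bicharacter G R"
    by (simp add: abelian_cocycle3_def cocycle3_def normalized3_def triv3_def bicharacter_def)
  then show ?thesis
    by (simp add: Z3ab_def triv3_def)
qed

lemma bicharacter_one:
  assumes "comm_group G" "R \<in> carrier (cochains (G2 G) k)" "bicharacter G R" "x \<in> carrier G"
  shows "R (\<one>\<^bsub>G\<^esub>, x) = 1" "R (x, \<one>\<^bsub>G\<^esub>) = 1"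
proof -
  interpret comm_group G by fact
  have "R (\<one>\<^bsub>G\<^esub> \<otimes>\<^bsub>G\<^esub> \<one>\<^bsub>G\<^esub>, x) = R (\<one>\<^bsub>G\<^esub>, x) * R (\<one>\<^bsub>G\<^esub>, x)"
    "R (x, \<one>\<^bsub>G\<^esub> \<otimes>\<^bsub>G\<^esub> \<one>\<^bsub>G\<^esub>) = R (x, \<one>\<^bsub>G\<^esub>) * R (x, \<one>\<^bsub>G\<^esub>)"
    using assms(3,4) unfolding bicharacter_def by blast+
  moreover have "R (\<one>\<^bsub>G\<^esub>, x) \<noteq> 0" "R (x, \<one>\<^bsub>G\<^esub>) \<noteq> 0"
    using assms(2,4) by auto
  ultimately show "R (\<one>\<^bsub>G\<^esub>, x) = 1" "R (x, \<one>\<^bsub>G\<^esub>) = 1"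
    by simp_all
qed

text \<open>Expanding both sides of the cubic identity by bimultiplicativity gives the same product: each
  \<open>R(x, x)\<close> occurs twice, and each mixed value once.\<close>
lemma quadratic_form_diagonal:
  assumes "comm_group G" "R \<in> carrier (cochains (G2 G) k)" "bicharacter G R"
  shows "(\<lambda>x\<in>carrier G. R (x, x)) \<in> carrier (QF G k)"
proof -
  interpret comm_group G by fact
  have nz: "R (x, y) \<noteq> 0" if "x \<in> carrier G" "y \<in> carrier G" for x y
    using assms(2) that by auto
  have add: "R (x \<otimes>\<^bsub>G\<^esub> y, z) = R (x, z) * R (y, z)" "R (x, y \<otimes>\<^bsub>G\<^esub> z) = R (x, y) * R (x, z)"
    if "x \<in> carrier G" "y \<in> carrier G" "z \<in> carrier G" for x y z
    using assms(3) that by (auto simp: bicharacter_def)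
  have "R (inv\<^bsub>G\<^esub> x, inv\<^bsub>G\<^esub> x) = R (x, x)" if x: "x \<in> carrier G" for x
  proof -
    note one = bicharacter_one[OF assms]
    have "R (inv\<^bsub>G\<^esub> x, inv\<^bsub>G\<^esub> x) * R (x, inv\<^bsub>G\<^esub> x) = 1"
      using x add(1)[of "inv\<^bsub>G\<^esub> x" x "inv\<^bsub>G\<^esub> x"] one(1)[of "inv\<^bsub>G\<^esub> x"] by simp
    moreover have "R (x, x) * R (x, inv\<^bsub>G\<^esub> x) = 1"
      using x add(2)[of x x "inv\<^bsub>G\<^esub> x"] one(2)[of x] by simp
    ultimately show ?thesis
      by (metis mult_cancel_right zero_neq_one mult_zero_right)
  qed
  then show ?thesis
    by (auto simp: QF_def quadratic_form_def add nz)
qed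


section \<open>Classes over the trivial class\<close>

text \<open>This is how representatives are changed: first to make \<open>\<phi>\<close> trivial, then to
  make one entry of \<open>R\<close> equal to \<open>1\<close>.\<close>
lemma H3ab_class_coboundary:
  assumes "comm_group G" "b \<in> B3ab G TYPE('k::field)" "p \<in> carrier (Z3ab G TYPE('k))"
  shows "H3ab_class G (b \<otimes>\<^bsub>Z3ab G TYPE('k)\<^esub> p) = H3ab_class G p"
proof -
  interpret comm_group G by fact
  interpret Zab: comm_group "Z3ab G TYPE('k)" by (rule comm_group_Z3ab) (rule is_group)
  show ?thesis
    unfolding H3ab_class_def
    by (rule Zab.repr_independence[symmetric])
      (use assms subgroup_B3ab[OF assms(1)] in \<open>auto simp: r_coset_def\<close>)
qed

lemma H3ab_class_carrier:
  assumes "p \<in> carrier (Z3ab G TYPE('k::field))"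
  shows "H3ab_class G p \<in> carrier (H3ab G TYPE('k))"
  using assms by (auto simp: H3ab_def H3ab_class_def carrier_FactGroup)

text \<open>The delicate point is that \<open>\<phi>\<close> is only known to be an ordinary coboundary \<open>\<Delta>\<^sub>2 \<psi>\<close>, whereas
  abelian coboundaries require \<open>\<psi>\<close> to be constant on the axes. Since \<open>\<phi>\<close> is normalized, that is
  automatic: \<open>\<Delta>\<^sub>2 \<psi> (y, e, x) = \<psi>(e, x) \<psi>(y, e)\<^sup>-\<^sup>1\<close>.\<close>
lemma \<pi>_fibre_one_bicharacter:
  assumes "comm_group G" "X \<in> \<pi>_fibre_one G TYPE('k::field)"
  obtains R where "R \<in> carrier (cochains (G2 G) TYPE('k))" "bicharacter G R"
    "X = H3ab_class G (triv3 G TYPE('k), R)"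
proof -
  interpret comm_group G by fact
  interpret Z: comm_group "Z3 G TYPE('k)" by (rule comm_group_Z3) (rule is_group)
  interpret Zab: comm_group "Z3ab G TYPE('k)" by (rule comm_group_Z3ab) (rule is_group)
  note B3 = subgroup_B3[OF is_group, of "TYPE('k)"]
  note B3ab = subgroup_B3ab[OF assms(1), of "TYPE('k)"]
  from assms(2) have "X \<in> carrier (H3ab G TYPE('k))"
    by (simp add: \<pi>_fibre_one_def)
  then obtain \<phi> S where p: "(\<phi>, S) \<in> carrier (Z3ab G TYPE('k))" and X: "X = H3ab_class G (\<phi>, S)"
    by (rule H3ab_carrierE)
  have \<phi>: "\<phi> \<in> carrier (Z3 G TYPE('k))" "normalized3 G \<phi>"
    using p by (simp_all add: Z3_def Z3ab_def abelian_cocycle3_def)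
  have "H3_class G \<phi> = H3_class G (triv3 G TYPE('k))"
    using assms(2) \<pi>_class[OF assms(1) p] by (simp add: X \<pi>_fibre_one_def)
  also have "\<dots> = B3 G TYPE('k)"
    unfolding H3_class_def triv3_eq using subgroup.subset[OF B3] by (rule Z.coset_mult_one)
  finally have "\<phi> \<in> B3 G TYPE('k)"
    unfolding H3_class_def using Z.rcos_self[OF \<phi>(1) B3] by simp
  then obtain \<psi> where \<psi>: "\<psi> \<in> carrier (cochains (G2 G) TYPE('k))" "\<phi> = \<Delta>2 G \<psi>"
    by (auto simp: B3_def)
  have nz: "\<psi> (x, y) \<noteq> 0" if "x \<in> carrier G" "y \<in> carrier G" for x y
    using \<psi>(1) that by auto
  have "\<psi> (\<one>\<^bsub>G\<^esub>, x) = \<psi> (y, \<one>\<^bsub>G\<^esub>)" if "x \<in> carrier G" "y \<in> carrier G" for x y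
  proof -
    have "\<phi> (y, \<one>\<^bsub>G\<^esub>, x) = 1"
      using \<phi>(2) that by (simp add: normalized3_def)
    then show ?thesis
      using that by (simp add: \<psi>(2) \<Delta>2_def nz field_simps)
  qed
  then have b: "(\<phi>, R_cob G \<psi>) \<in> B3ab G TYPE('k)" (is "?b \<in> _")
    using \<psi> by (auto simp: B3ab_def)
  then have bZ: "?b \<in> carrier (Z3ab G TYPE('k))"
    using B3ab by (rule subgroup.mem_carrier[rotated])
  \<comment> \<open>Dividing by this coboundary leaves first component \<open>1\<close>, since \<open>\<phi> * \<phi>' = \<phi>\<close> below.\<close>
  obtain \<phi>' R where q: "inv\<^bsub>Z3ab G TYPE('k)\<^esub> ?b \<otimes>\<^bsub>Z3ab G TYPE('k)\<^esub> (\<phi>, S) = (\<phi>', R)"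
    by fastforce
  have qZ: "(\<phi>', R) \<in> carrier (Z3ab G TYPE('k))"
    unfolding q[symmetric] using bZ p by simp
  have "?b \<otimes>\<^bsub>Z3ab G TYPE('k)\<^esub> (\<phi>', R) = (\<phi>, S)"
    unfolding q[symmetric] using bZ p by (simp add: Zab.m_assoc[symmetric])
  then have "(\<lambda>x\<in>G3 G. \<phi> x * \<phi>' x) = \<phi>"
    by (simp add: Z3ab_def)
  then have "\<phi> x * \<phi>' x = \<phi> x" if "x \<in> G3 G" for x
    using restrict_apply'[OF that, of "\<lambda>x. \<phi> x * \<phi>' x"] by (simp only:)
  moreover have "\<phi> x \<noteq> 0" if "x \<in> G3 G" for x
    using \<phi>(1) that by (auto simp: Z3_def)
  moreover have "\<phi>' \<in> extensional (G3 G)"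
    using qZ by (auto simp: Z3ab_def PiE_def)
  ultimately have "\<phi>' = triv3 G TYPE('k)"
    unfolding triv3_def by (intro extensionalityI[of _ "G3 G"]) auto
  with qZ have "(triv3 G TYPE('k), R) \<in> carrier (Z3ab G TYPE('k))"
    by simp
  moreover have "X = H3ab_class G (triv3 G TYPE('k), R)"
    using H3ab_class_coboundary[OF assms(1) subgroup.m_inv_closed[OF B3ab b] p] q X
      \<open>\<phi>' = triv3 G TYPE('k)\<close> by simp
  ultimately show thesis
    using that triv3_Z3ab_iff[OF assms(1)] by blast
qed

lemma \<pi>_fibre_oneI:
  assumes "comm_group G" "R \<in> carrier (cochains (G2 G) TYPE('k::field))" "bicharacter G R"
  shows "H3ab_class G (triv3 G TYPE('k), R) \<in> \<pi>_fibre_one G TYPE('k)"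
proof -
  have "(triv3 G TYPE('k), R) \<in> carrier (Z3ab G TYPE('k))"
    using assms triv3_Z3ab_iff by blast
  then show ?thesis
    using \<pi>_class[OF assms(1)] H3ab_class_carrier by (auto simp: \<pi>_fibre_one_def)
qed

text \<open>A bicharacter \<open>\<psi>\<close> satisfies the 2-cocycle condition, so its coboundary has trivial first
  component but in general a nontrivial second one: the commutator pairing \<open>\<psi>(y,x) / \<psi>(x,y)\<close>.
  These coboundaries identify different bicharacters within one class.\<close>
lemma bicharacter_coboundary:
  assumes "comm_group G" "\<psi> \<in> carrier (cochains (G2 G) k)" "bicharacter G \<psi>"
  shows "(triv3 G k, R_cob G \<psi>) \<in> B3ab G k"
proof -
  interpret comm_group G by fact
  have nz: "\<psi> (x, y) \<noteq> 0" if "x \<in> carrier G" "y \<in> carrier G" for x y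
    using assms(2) that by auto
  have add: "\<psi> (x \<otimes>\<^bsub>G\<^esub> y, z) = \<psi> (x, z) * \<psi> (y, z)" "\<psi> (x, y \<otimes>\<^bsub>G\<^esub> z) = \<psi> (x, y) * \<psi> (x, z)"
    if "x \<in> carrier G" "y \<in> carrier G" "z \<in> carrier G" for x y z
    using assms(3) that by (auto simp: bicharacter_def)
  have "\<Delta>2 G \<psi> = triv3 G k"
    unfolding \<Delta>2_def triv3_def by (rule restrict_ext) (auto simp: add nz field_simps)
  moreover have "\<psi> (\<one>\<^bsub>G\<^esub>, x) = \<psi> (y, \<one>\<^bsub>G\<^esub>)" if "x \<in> carrier G" "y \<in> carrier G" for x y
    using bicharacter_one[OF assms] that by simp
  ultimately have "(triv3 G k, R_cob G \<psi>) = (\<Delta>2 G \<psi>, R_cob G \<psi>)"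
    and "\<psi> \<in> {\<psi> \<in> carrier (cochains (G2 G) k).
      \<forall>x\<in>carrier G. \<forall>y\<in>carrier G. \<psi> (\<one>\<^bsub>G\<^esub>, x) = \<psi> (y, \<one>\<^bsub>G\<^esub>)}"
    using assms(2) by (simp_all del: cochains_simps)
  then show ?thesis
    unfolding B3ab_def by (rule image_eqI)
qed


section \<open>Bicharacters of the Klein group\<close>

definition sign :: "int \<Rightarrow> 'k::field" where
  "sign n = (if even n then 1 else - 1)"

lemma sign_simps [simp]: "sign 0 = 1" "sign 1 = - 1" "sign n \<noteq> 0" "sign (n mod 2) = sign n"
  by (auto simp: sign_def)

lemma sign_add: "sign (m + n) = sign m * sign n"
  by (simp add: sign_def)

lemma sign_mod:
  "sign ((m mod 2) * x * y) = sign (m * x * y)" "sign (x * (m mod 2) * y) = sign (x * m * y)"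
  "sign (x * y * (m mod 2)) = sign (x * y * m)"
  by (simp_all add: sign_def)

lemma sign_square [simp]: "sign n * (sign n * x) = x"
  by (simp add: sign_def)

lemma minus_one_neq_one:
  assumes "CHAR('k::field) \<noteq> 2"
  shows "(- 1 :: 'k) \<noteq> 1"
proof
  assume "(- 1 :: 'k) = 1"
  then have "of_nat 2 = (0 :: 'k)"
    by (metis add.right_inverse of_nat_numeral one_add_one)
  then have "CHAR('k) dvd 2"
    by (simp only: of_nat_eq_0_iff_char_dvd)
  moreover from this have "CHAR('k) \<le> 2"
    by (rule dvd_imp_le) simp
  moreover have "CHAR('k) \<noteq> 1"
    unfolding One_nat_def by (rule CHAR_not_1)
  moreover have "CHAR('k) \<noteq> 0"
    using \<open>CHAR('k) dvd 2\<close> by (metis dvd_0_left zero_neq_numeral)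
  ultimately have "CHAR('k) = 2"
    by linarith
  with assms show False ..
qed

abbreviation C2_cubed :: "(int \<times> int \<times> int) monoid" where
  "C2_cubed \<equiv> C2 \<times>\<times> C2 \<times>\<times> C2"

text \<open>The bicharacter \<open>(-1)\<^sup>f\<close> of the bilinear form \<open>f\<close> over the integers modulo 2 with matrix entries
  \<open>f(\<sigma>,\<sigma>) = a\<close>, \<open>f(\<tau>,\<tau>) = b\<close>, \<open>f(\<tau>,\<sigma>) = c\<close> and \<open>f(\<sigma>,\<tau>) = 0\<close>.\<close>
definition sign_form :: "int \<times> int \<times> int \<Rightarrow> (int \<times> int) \<times> (int \<times> int) \<Rightarrow> 'k::field" where
  "sign_form = (\<lambda>(a, b, c). \<lambda>((x1, x2), (y1, y2))\<in>G2 V4.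
     sign (a * x1 * y1 + b * x2 * y2 + c * x2 * y1))"

lemma C2_carrier: "carrier C2 = {0, 1}"
  by (auto simp: carrier_integer_mod_group)

lemma comm_group_C2_cubed: "comm_group C2_cubed"
proof -
  have "group C2_cubed" by (intro DirProd_group group_integer_mod_group)
  then show ?thesis
    by (rule group.group_comm_groupI) (auto simp: add.commute)
qed

lemma V4_elements: "e \<in> carrier V4" "\<sigma> \<in> carrier V4" "\<tau> \<in> carrier V4" "\<rho> \<in> carrier V4"
  unfolding carrier_V4 by simp_all

lemma sign_form_cochain: "sign_form abc \<in> carrier (cochains (G2 V4) k)"
  by (auto simp: sign_form_def split: prod.splits)

lemma sign_form_bicharacter: "bicharacter V4 (sign_form abc)"
  unfolding bicharacter_def
  by (cases abc)
    (auto simp: sign_form_def carrier_integer_mod_group sign_add sign_mod distrib_left distrib_right)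

lemma sign_form_mult:
  "sign_form (p \<otimes>\<^bsub>C2_cubed\<^esub> q) = (\<lambda>x\<in>G2 V4. sign_form p x * sign_form q x)"
  by (cases p; cases q)
    (auto simp: sign_form_def fun_eq_iff sign_add sign_mod distrib_right)

text \<open>The table of values of a normalized bicharacter with diagonal \<open>\<mu>\<close>; the normalization is
  the entry \<open>R(\<sigma>, \<tau>) = 1\<close>.\<close>
definition normal_table ::
  "((int \<times> int) \<times> (int \<times> int) \<Rightarrow> 'k::field) \<Rightarrow> (int \<times> int \<Rightarrow> 'k) \<Rightarrow> bool" where
  "normal_table R \<mu> \<longleftrightarrow>
    (\<forall>x\<in>carrier V4. R (e, x) = 1 \<and> R (x, e) = 1) \<and>
    (\<forall>x\<in>{\<sigma>, \<tau>, \<rho>}. R (x, x) = \<mu> x \<and> (\<mu> x)\<^sup>2 = 1) \<and>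
    R (\<sigma>, \<tau>) = 1 \<and> R (\<tau>, \<sigma>) = \<mu> \<sigma> * \<mu> \<tau> * \<mu> \<rho> \<and> R (\<sigma>, \<rho>) = \<mu> \<sigma> \<and>
    R (\<rho>, \<sigma>) = \<mu> \<tau> * \<mu> \<rho> \<and> R (\<tau>, \<rho>) = \<mu> \<sigma> * \<mu> \<rho> \<and> R (\<rho>, \<tau>) = \<mu> \<tau>"

text \<open>Every element of the Klein group has order two, so each value squares to \<open>1\<close>, and \<open>\<rho> = \<sigma>\<tau>\<close>
  reduces the table to the four entries at pairs of generators.\<close>
lemma bicharacter_V4:
  assumes "R \<in> carrier (cochains (G2 V4) k)" "bicharacter V4 R"
  shows "x \<in> carrier V4 \<Longrightarrow> R (e, x) = 1" "x \<in> carrier V4 \<Longrightarrow> R (x, e) = 1"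
    "R (\<sigma>, \<sigma>) * R (\<sigma>, \<sigma>) = 1" "R (\<tau>, \<tau>) * R (\<tau>, \<tau>) = 1"
    "R (\<sigma>, \<tau>) * R (\<sigma>, \<tau>) = 1" "R (\<tau>, \<sigma>) * R (\<tau>, \<sigma>) = 1"
    "R (\<sigma>, \<rho>) = R (\<sigma>, \<sigma>) * R (\<sigma>, \<tau>)" "R (\<tau>, \<rho>) = R (\<tau>, \<sigma>) * R (\<tau>, \<tau>)"
    "R (\<rho>, \<sigma>) = R (\<sigma>, \<sigma>) * R (\<tau>, \<sigma>)" "R (\<rho>, \<tau>) = R (\<sigma>, \<tau>) * R (\<tau>, \<tau>)"
    "R (\<rho>, \<rho>) = R (\<sigma>, \<sigma>) * R (\<sigma>, \<tau>) * (R (\<tau>, \<sigma>) * R (\<tau>, \<tau>))"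
proof -
  note c = V4_elements(2-4)
  have add: "R (x \<otimes>\<^bsub>V4\<^esub> y, z) = R (x, z) * R (y, z)" "R (x, y \<otimes>\<^bsub>V4\<^esub> z) = R (x, y) * R (x, z)"
    if "x \<in> carrier V4" "y \<in> carrier V4" "z \<in> carrier V4" for x y z
    using assms(2) that unfolding bicharacter_def by blast+
  note one = bicharacter_one[OF comm_group_V4 assms, unfolded V4_mult]
  show "x \<in> carrier V4 \<Longrightarrow> R (e, x) = 1" "x \<in> carrier V4 \<Longrightarrow> R (x, e) = 1"
    by (fact one)+
  show "R (\<sigma>, \<sigma>) * R (\<sigma>, \<sigma>) = 1" "R (\<tau>, \<tau>) * R (\<tau>, \<tau>) = 1"
    "R (\<sigma>, \<tau>) * R (\<sigma>, \<tau>) = 1" "R (\<tau>, \<sigma>) * R (\<tau>, \<sigma>) = 1"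
    using add(1)[of \<sigma> \<sigma> \<sigma>] add(1)[of \<tau> \<tau> \<tau>] add(1)[of \<sigma> \<sigma> \<tau>] add(1)[of \<tau> \<tau> \<sigma>]
      one[OF c(1)] one[OF c(2)] c unfolding V4_mult by simp_all
  show rho: "R (\<sigma>, \<rho>) = R (\<sigma>, \<sigma>) * R (\<sigma>, \<tau>)" "R (\<tau>, \<rho>) = R (\<tau>, \<sigma>) * R (\<tau>, \<tau>)"
    "R (\<rho>, \<sigma>) = R (\<sigma>, \<sigma>) * R (\<tau>, \<sigma>)" "R (\<rho>, \<tau>) = R (\<sigma>, \<tau>) * R (\<tau>, \<tau>)"
    using add(2)[of \<sigma> \<sigma> \<tau>] add(2)[of \<tau> \<sigma> \<tau>] add(1)[of \<sigma> \<tau> \<sigma>] add(1)[of \<sigma> \<tau> \<tau>] c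
    unfolding V4_mult by simp_all
  show "R (\<rho>, \<rho>) = R (\<sigma>, \<sigma>) * R (\<sigma>, \<tau>) * (R (\<tau>, \<sigma>) * R (\<tau>, \<tau>))"
    using add(1)[of \<sigma> \<tau> \<rho>] c unfolding V4_mult rho by simp
qed

lemma normal_table_bicharacter:
  assumes "R \<in> carrier (cochains (G2 V4) k)" "bicharacter V4 R" "R (\<sigma>, \<tau>) = 1"
  shows "normal_table R (\<lambda>x. R (x, x))"
proof -
  note t = bicharacter_V4[OF assms(1,2)]
  have "R (\<sigma>, \<sigma>) = 1 \<or> R (\<sigma>, \<sigma>) = -1" "R (\<tau>, \<tau>) = 1 \<or> R (\<tau>, \<tau>) = -1"
    "R (\<tau>, \<sigma>) = 1 \<or> R (\<tau>, \<sigma>) = -1"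
    using t(3,4,6) by (simp_all only: square_eq_1_iff)
  then show ?thesis
    unfolding normal_table_def using t(1,2) by (auto simp: t(7-) assms(3))
qed

lemma normal_table_unique:
  assumes "R \<in> carrier (cochains (G2 V4) k)" "normal_table R \<mu>"
    and "S \<in> carrier (cochains (G2 V4) k)" "normal_table S \<nu>"
    and "\<mu> \<sigma> = \<nu> \<sigma>" "\<mu> \<tau> = \<nu> \<tau>" "\<mu> \<rho> = \<nu> \<rho>"
  shows "R = S"
proof (rule extensionalityI[of _ "G2 V4"])
  show "R \<in> extensional (G2 V4)" "S \<in> extensional (G2 V4)"
    using assms(1,3) by (simp_all add: PiE_def)
  show "R p = S p" if "p \<in> G2 V4" for p
    using that assms(2,4-) unfolding carrier_V4 normal_table_def
    by auto
qed

lemma sign_form_normal_table: "normal_table (sign_form abc) (\<lambda>x. sign_form abc (x, x))"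
proof (rule normal_table_bicharacter[OF sign_form_cochain sign_form_bicharacter])
  show "sign_form abc (\<sigma>, \<tau>) = 1"
    by (cases abc) (simp add: sign_form_def \<sigma>_def \<tau>_def C2_carrier)
qed

text \<open>A table is determined by its diagonal signs, so it suffices to find a sign form with the same
  diagonal. The value of a sign form at \<open>(\<rho>, \<rho>)\<close> has exponent \<open>a + b + c\<close>; if it is to be \<open>d\<close>, then
  \<open>c = a + b + d\<close> modulo 2.\<close>
lemma normal_table_sign_form:
  assumes "R \<in> carrier (cochains (G2 V4) k)" "normal_table R \<mu>"
  obtains abc where "abc \<in> carrier C2_cubed" "R = sign_form abc"
proof -
  have "\<exists>n\<in>carrier C2. \<mu> x = sign n" if "x \<in> {\<sigma>, \<tau>, \<rho>}" for x
  proof -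
    have "(\<mu> x)\<^sup>2 = 1"
      using assms(2) that unfolding normal_table_def by blast
    then show ?thesis
      by (auto simp: power2_eq_1_iff C2_carrier)
  qed
  then obtain a b d where ab: "a \<in> carrier C2" "\<mu> \<sigma> = sign a" "b \<in> carrier C2" "\<mu> \<tau> = sign b"
    "d \<in> carrier C2" "\<mu> \<rho> = sign d"
    by (metis insertCI)
  let ?c = "(a + b + d) mod 2"
  have "R = sign_form (a, b, ?c)"
    by (rule normal_table_unique[OF assms sign_form_cochain sign_form_normal_table]; unfold ab)
      (simp_all add: sign_form_def \<sigma>_def \<tau>_def \<rho>_def C2_carrier sign_add mult_ac)
  moreover have "(a, b, ?c) \<in> carrier C2_cubed"
    using ab by (simp add: carrier_integer_mod_group)
  ultimately show thesis by (rule that[rotated])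
qed

text \<open>Since \<open>R(\<sigma>, \<tau>)\<close> squares to \<open>1\<close>, it is enough to be able to change its sign by a coboundary
  with trivial first component.\<close>
lemma \<pi>_fibre_one_normal_table:
  assumes "X \<in> \<pi>_fibre_one V4 TYPE('k::field)"
  obtains R \<mu> where "R \<in> carrier (cochains (G2 V4) TYPE('k))" "normal_table R \<mu>"
    "X = H3ab_class V4 (triv3 V4 TYPE('k), R)"
proof -
  interpret Zab: comm_group "Z3ab V4 TYPE('k)"
    by (rule comm_group_Z3ab) (rule comm_group.axioms(2)[OF comm_group_V4])
  obtain R where R: "R \<in> carrier (cochains (G2 V4) TYPE('k))" "bicharacter V4 R"
    "X = H3ab_class V4 (triv3 V4 TYPE('k), R)"
    using \<pi>_fibre_one_bicharacter[OF comm_group_V4 assms] .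
  consider "R (\<sigma>, \<tau>) = 1" | "R (\<sigma>, \<tau>) = -1"
    using bicharacter_V4(5)[OF R(1,2)] by (auto simp only: square_eq_1_iff)
  then show thesis
  proof cases
    case 1
    then show thesis using R normal_table_bicharacter that by blast
  next
    case 2
    \<comment> \<open>The commutator pairing of \<open>(-1)\<^sup>f\<close> with \<open>f(x, y) = x\<^sub>2 y\<^sub>1\<close> takes the value \<open>-1\<close> at \<open>(\<sigma>, \<tau>)\<close>
      and is trivial on the diagonal.\<close>
    define S :: "(int \<times> int) \<times> (int \<times> int) \<Rightarrow> 'k" where "S = R_cob V4 (sign_form (0, 0, 1))"
    have S: "(triv3 V4 TYPE('k), S) \<in> B3ab V4 TYPE('k)"
      unfolding S_def
      by (rule bicharacter_coboundary[OF comm_group_V4 sign_form_cochain sign_form_bicharacter])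
    have "S (\<sigma>, \<tau>) = -1"
      by (simp add: S_def R_cob_def sign_form_def \<sigma>_def \<tau>_def C2_carrier)
    define R' where "R' = (\<lambda>x\<in>G2 V4. S x * R x)"
    have RZ: "(triv3 V4 TYPE('k), R) \<in> carrier (Z3ab V4 TYPE('k))"
      using R triv3_Z3ab_iff[OF comm_group_V4] by blast
    have SZ: "(triv3 V4 TYPE('k), S) \<in> carrier (Z3ab V4 TYPE('k))"
      using subgroup_B3ab[OF comm_group_V4] S by (rule subgroup.mem_carrier)
    have prod: "(triv3 V4 TYPE('k), S) \<otimes>\<^bsub>Z3ab V4 TYPE('k)\<^esub> (triv3 V4 TYPE('k), R) =
        (triv3 V4 TYPE('k), R')"
      by (simp add: Z3ab_def R'_def triv3_def cong: restrict_cong)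
    have "R' \<in> carrier (cochains (G2 V4) TYPE('k))" "bicharacter V4 R'"
      using Zab.m_closed[OF SZ RZ] triv3_Z3ab_iff[OF comm_group_V4] unfolding prod by blast+
    moreover have "R' (\<sigma>, \<tau>) = 1"
      using 2 \<open>S (\<sigma>, \<tau>) = -1\<close> by (simp only: R'_def restrict_apply' mem_Sigma_iff V4_elements) simp
    moreover have "X = H3ab_class V4 (triv3 V4 TYPE('k), R')"
      using H3ab_class_coboundary[OF comm_group_V4 S RZ] R(3) by (simp only: prod)
    ultimately show thesis
      using normal_table_bicharacter that by blast
  qed
qed


section \<open>Parametrization by three signs\<close>

definition fibre_param ::
  "'k::field itself \<Rightarrow> int \<times> int \<times> int \<Rightarrow>
    (((int \<times> int) \<times> (int \<times> int) \<times> (int \<times> int) \<Rightarrow> 'k) \<times> ((int \<times> int) \<times> (int \<times> int) \<Rightarrow> 'k)) set"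
  where "fibre_param k abc = H3ab_class V4 (triv3 V4 k, sign_form abc)"

definition sign_quadratic :: "int \<times> int \<times> int \<Rightarrow> int \<times> int \<Rightarrow> 'k::field" where
  "sign_quadratic abc = (\<lambda>x\<in>carrier V4. sign_form abc (x, x))"

lemma sign_form_Z3ab:
  "(triv3 V4 TYPE('k::field), sign_form abc) \<in> carrier (Z3ab V4 TYPE('k))"
  using triv3_Z3ab_iff[OF comm_group_V4] sign_form_cochain sign_form_bicharacter by blast

lemma fibre_param_hom: "fibre_param TYPE('k::field) \<in> hom C2_cubed (H3ab V4 TYPE('k))"
proof (rule homI)
  fix p q :: "int \<times> int \<times> int"
  show "fibre_param TYPE('k) p \<in> carrier (H3ab V4 TYPE('k))"
    unfolding fibre_param_def by (rule H3ab_class_carrier[OF sign_form_Z3ab])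
  have "(triv3 V4 TYPE('k), sign_form p) \<otimes>\<^bsub>Z3ab V4 TYPE('k)\<^esub> (triv3 V4 TYPE('k), sign_form q) =
      (triv3 V4 TYPE('k), sign_form (p \<otimes>\<^bsub>C2_cubed\<^esub> q))"
    unfolding sign_form_mult by (simp add: Z3ab_def triv3_def cong: restrict_cong)
  then show "fibre_param TYPE('k) (p \<otimes>\<^bsub>C2_cubed\<^esub> q) =
      fibre_param TYPE('k) p \<otimes>\<^bsub>H3ab V4 TYPE('k)\<^esub> fibre_param TYPE('k) q"
    unfolding fibre_param_def H3ab_class_mult[OF comm_group_V4 sign_form_Z3ab sign_form_Z3ab]
    by (simp only:)
qed

lemma EM_fibre_param: "EM V4 (fibre_param TYPE('k::field) abc) = (sign_quadratic abc :: _ \<Rightarrow> 'k)"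
  unfolding fibre_param_def sign_quadratic_def
  by (rule EM_class[OF comm_group_V4 sign_form_Z3ab])

text \<open>The diagonal of the bilinear form is \<open>a x\<^sub>1\<^sup>2 + b x\<^sub>2\<^sup>2 + c x\<^sub>1 x\<^sub>2\<close>, and coordinates \<open>0, 1\<close>
  are idempotent.\<close>
lemma sign_quadratic_apply:
  assumes "x \<in> carrier V4"
  shows "sign_quadratic (a, b, c) x = sign (a * fst x + b * snd x + c * fst x * snd x)"
  using assms by (auto simp: sign_quadratic_def sign_form_def C2_carrier)

lemma sign_quadratic_hom: "(sign_quadratic :: _ \<Rightarrow> _ \<Rightarrow> 'k::field) \<in> hom C2_cubed (QF V4 k)"
proof (rule homI)
  fix p q :: "int \<times> int \<times> int"
  show "(sign_quadratic p :: _ \<Rightarrow> 'k) \<in> carrier (QF V4 k)"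
    unfolding sign_quadratic_def
    by (rule quadratic_form_diagonal[OF comm_group_V4 sign_form_cochain sign_form_bicharacter])
  show "(sign_quadratic (p \<otimes>\<^bsub>C2_cubed\<^esub> q) :: _ \<Rightarrow> 'k) =
      sign_quadratic p \<otimes>\<^bsub>QF V4 k\<^esub> sign_quadratic q"
    unfolding sign_quadratic_def sign_form_mult by (auto simp: QF_def fun_eq_iff)
qed

text \<open>The values at \<open>\<sigma>\<close>, \<open>\<tau>\<close> and \<open>\<rho>\<close> have exponents \<open>a\<close>, \<open>b\<close> and \<open>a + b + c\<close>. Recovering parities from
  signs is where the characteristic enters.\<close>
lemma inj_sign_quadratic:
  assumes "CHAR('k::field) \<noteq> 2"
  shows "inj_on (sign_quadratic :: _ \<Rightarrow> _ \<Rightarrow> 'k) (carrier C2_cubed)"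
proof (rule inj_onI)
  fix p q assume pq: "p \<in> carrier C2_cubed" "q \<in> carrier C2_cubed"
    and eq: "(sign_quadratic p :: _ \<Rightarrow> 'k) = sign_quadratic q"
  obtain a b c a' b' c' where p: "p = (a, b, c)" and q: "q = (a', b', c')"
    by (metis prod_cases3)
  have "(sign_quadratic p x :: 'k) = sign_quadratic q x" for x
    by (simp only: eq)
  from this[of \<sigma>] this[of \<tau>] this[of \<rho>] have
    "(sign a :: 'k) = sign a'" "(sign b :: 'k) = sign b'"
    "(sign (a + b + c) :: 'k) = sign (a' + b' + c')"
    unfolding p q
    by (simp_all only: sign_quadratic_apply V4_elements)
       (simp_all add: \<sigma>_def \<tau>_def \<rho>_def)
  then show "p = q"
    using pq minus_one_neq_one[OF assms] unfolding p q
    by (auto simp: C2_carrier sign_add)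
qed

lemma qABC_sign_quadratic:
  "qA = sign_quadratic (0, 0, 1)" "qB = sign_quadratic (0, 1, 1)" "qC = sign_quadratic (1, 0, 1)"
  by (rule extensionalityI[of _ "carrier V4"];
      (simp add: qA_def qB_def qC_def sign_quadratic_def; fail)?;
      auto simp: qA_def qB_def qC_def sign_quadratic_apply C2_carrier \<sigma>_def \<tau>_def \<rho>_def sign_def)+

lemma generate_C2_cubed: "generate C2_cubed {(0, 0, 1), (0, 1, 1), (1, 0, 1)} = carrier C2_cubed"
    (is "generate _ ?U = _")
proof
  interpret comm_group C2_cubed by (rule comm_group_C2_cubed)
  show "generate C2_cubed ?U \<subseteq> carrier C2_cubed"
    by (rule generate_incl) (simp add: C2_carrier)
  have u: "(0, 0, 1) \<in> generate C2_cubed ?U" and v: "(0, 1, 1) \<in> generate C2_cubed ?U"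
    and w: "(1, 0, 1) \<in> generate C2_cubed ?U"
    by (simp_all add: generate.incl)
  note uv = generate.eng[OF u v] and uw = generate.eng[OF u w] and vw = generate.eng[OF v w]
  show "carrier C2_cubed \<subseteq> generate C2_cubed ?U"
    using generate.one[of C2_cubed ?U] u v w uv uw vw generate.eng[OF u vw]
    by (auto simp: C2_carrier)
qed

text \<open>The logic does not identify all terms of type \<open>'k itself\<close>, so the passage from an arbitrary one to
  \<open>TYPE('k)\<close> goes through the definitions.\<close>
lemma type_argument_irrelevant:
  fixes k :: "'k::field itself"
  shows "H3ab G k = H3ab G TYPE('k)" "\<pi>_fibre_one G k = \<pi>_fibre_one G TYPE('k)"
    "triv3 G k = triv3 G TYPE('k)" "QF G k = QF G TYPE('k)"
    "cochains I k = cochains I TYPE('k)"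
proof -
  show c: "cochains I k = cochains I TYPE('k)" for I :: "'i set"
    by (simp add: cochains_def kstar_def)
  show t: "triv3 G k = triv3 G TYPE('k)"
    by (simp add: triv3_def)
  show "QF G k = QF G TYPE('k)"
    unfolding QF_def c[of "carrier G"] ..
  show h: "H3ab G k = H3ab G TYPE('k)"
    unfolding H3ab_def Z3ab_def B3ab_def c[of "G2 G"] c[of "G3 G"] ..
  show "\<pi>_fibre_one G k = \<pi>_fibre_one G TYPE('k)"
    unfolding \<pi>_fibre_one_def h t ..
qed

theorem proposition4p3:
  fixes k :: "'k::field itself"
  assumes "CHAR('k) \<noteq> 2"
  shows "subgroup (\<pi>_fibre_one V4 k) (H3ab V4 k) \<and>
    (H3ab V4 k)\<lparr>carrier := \<pi>_fibre_one V4 k\<rparr> \<cong> C2 \<times>\<times> C2 \<times>\<times> C2 \<and>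
    \<pi>_fibre_one V4 k =
      {H3ab_class V4 (triv3 V4 k, R) | R \<mu>.
        R \<in> carrier (cochains (G2 V4) k) \<and>
        (\<forall>x\<in>carrier V4. R (e, x) = 1 \<and> R (x, e) = 1) \<and>
        (\<forall>x\<in>{\<sigma>, \<tau>, \<rho>}. R (x, x) = \<mu> x \<and> (\<mu> x)\<^sup>2 = 1) \<and>
        R (\<sigma>, \<tau>) = 1 \<and> R (\<tau>, \<sigma>) = \<mu> \<sigma> * \<mu> \<tau> * \<mu> \<rho> \<and> R (\<sigma>, \<rho>) = \<mu> \<sigma> \<and>
        R (\<rho>, \<sigma>) = \<mu> \<tau> * \<mu> \<rho> \<and> R (\<tau>, \<rho>) = \<mu> \<sigma> * \<mu> \<rho> \<and> R (\<rho>, \<tau>) = \<mu> \<tau>} \<and>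
    {qA, qB, qC} \<subseteq> carrier (QF V4 k) \<and>
    subgroup (EM V4 ` \<pi>_fibre_one V4 k) (QF V4 k) \<and>
    EM V4 ` \<pi>_fibre_one V4 k = generate (QF V4 k) {qA, qB, qC}"
proof -
  let ?k = "TYPE('k)"
  let ?F = "\<pi>_fibre_one V4 ?k" and ?h = "fibre_param ?k"
  let ?T = "{H3ab_class V4 (triv3 V4 ?k, R) | R \<mu>.
    R \<in> carrier (cochains (G2 V4) ?k) \<and> normal_table R \<mu>}"
  let ?q = "sign_quadratic :: _ \<Rightarrow> _ \<Rightarrow> 'k"
  interpret h: group_hom C2_cubed "H3ab V4 ?k" ?h
    using fibre_param_hom comm_group_C2_cubed comm_group_H3ab[OF comm_group_V4]
    by (auto simp: group_hom_def group_hom_axioms_def dest: comm_group.axioms)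
  interpret q: group_hom C2_cubed "QF V4 ?k" ?q
    using sign_quadratic_hom comm_group_C2_cubed comm_group_QF[OF comm_group_V4]
    by (auto simp: group_hom_def group_hom_axioms_def dest: comm_group.axioms)
  have "?F \<subseteq> ?T"
    by (blast elim: \<pi>_fibre_one_normal_table)
  moreover have "?T \<subseteq> ?h ` carrier C2_cubed"
    by (auto simp only: fibre_param_def elim!: normal_table_sign_form)
  moreover have "?h ` carrier C2_cubed \<subseteq> ?F"
    unfolding fibre_param_def
    using \<pi>_fibre_oneI[OF comm_group_V4 sign_form_cochain sign_form_bicharacter] by blast
  ultimately have FT: "?F = ?T" and Fh: "?F = ?h ` carrier C2_cubed"
    by blast+
  have EMF: "EM V4 ` ?F = ?q ` carrier C2_cubed"
    unfolding Fh image_image EM_fibre_param ..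
  \<comment> \<open>The parametrization is injective because its composition with \<open>EM\<close> is.\<close>
  have "inj_on (\<lambda>p. EM V4 (?h p)) (carrier C2_cubed)"
    unfolding EM_fibre_param by (rule inj_sign_quadratic[OF assms])
  then have "inj_on ?h (carrier C2_cubed)"
    by (rule inj_on_imageI2[unfolded comp_def])
  then have "?h \<in> iso C2_cubed ((H3ab V4 ?k)\<lparr>carrier := ?F\<rparr>)"
    using fibre_param_hom[where 'k = 'k] unfolding Fh iso_def hom_def bij_betw_def by auto
  then have iso: "(H3ab V4 ?k)\<lparr>carrier := ?F\<rparr> \<cong> C2_cubed"
    using h.G.iso_sym is_isoI by blast
  have gens: "{qA, qB, qC} = ?q ` {(0, 0, 1), (0, 1, 1), (1, 0, 1)}"
    by (simp add: qABC_sign_quadratic)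
  have sub: "{(0, 0, 1), (0, 1, 1), (1, 0, 1)} \<subseteq> carrier C2_cubed"
    by (simp add: C2_carrier)
  have "{qA, qB, qC} \<subseteq> carrier (QF V4 ?k)"
    unfolding gens using sub q.hom_closed by blast
  moreover have "EM V4 ` ?F = generate (QF V4 ?k) {qA, qB, qC}"
    unfolding EMF gens q.generate_img[OF sub] generate_C2_cubed ..
  moreover have "subgroup ?F (H3ab V4 ?k)"
    unfolding Fh by (rule h.img_is_subgroup)
  moreover have "subgroup (EM V4 ` ?F) (QF V4 ?k)"
    unfolding EMF by (rule q.img_is_subgroup)
  ultimately show ?thesis
    using iso FT
    unfolding normal_table_def type_argument_irrelevant[of _ k] type_argument_irrelevant(5)[of _ k]
    by blast
qed

end
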